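(* Let $G$ be the Cayley graph of $\mathbb Z^2$ with generators $(1,0),(0,1)$ and their inverses. The set of CA local rules $f$ for $G$ such that $F_{G,f}\models\phi$ is $\Sigma^1_1$-hard, where $$\phi\;:=\;\exists y,\ y\to y\ \wedge\ \forall y'\,\forall y_1\,\forall y_2\,\forall y_3,\ \Bigl(y'\neq y\wedge y'\to y\wedge \bigwedge_{i=1}^3 y_i\to y'\Bigr)\Rightarrow \bigvee_{i\neq j}y_i=y_j .$$ (In words: there is a fixed point of $F_{G,f}$ each of whose preimages different from itself has at most two preimages.)
   Context: The Cayley graph of $\mathbb Z^2$ with generating set $\Delta=\{(\pm1,0),(0,\pm1)\}$ has vertex set $\mathbb Z^2$, a single vertex label and $E_\delta=\{(z,z+\delta)\}$. For $v$ and $w=w_1\cdots w_k\in\Delta^*$, $\mathcal R^w(v)$ is the set of endpoints of paths from $v$ labeled $w$; $\mathcal R^\epsilon(v)=\{v\}$. For a finite set $X$ and $k\ge1$, $\mathrm{MS}^k(X)=\{0,\dots,k\}^X$. For a finite state set $S$, $c\in S^{\mathbb Z^2}$, $r\ge0$, $k\ge1$, $P(c,v,r,k)\in\mathrm{MS}^k(\Delta^{\le r}\times S)$ is $(w,s)\mapsto\min(k,\#\{v'\in\mathcal R^w(v):c_{v'}=s\})$, where $\Delta^{\le r}$ is the set of words of length at most $r$. A CA local rule with state set $S$, radius $r$, using $k$-capped multisets is a map $f:\mathrm{MS}^k(\Delta^{\le r}\times S)\to S$; its global map is $F_{G,f}(c)_v=f(P(c,v,r,k))$. FO formulas over CA orbits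 have variables ranging over configurations, atomic formulas $y=y'$ and $y\to y'$ (meaning $F(y)=y'$). *)

theory Defs
  imports Main "HOL-Library.Nat_Bijection"
begin

datatype recf = Zero | Succ | Proj nat | Comp recf "recf list" | PrimRec recf recf | Mu recf

inductive eval_recf :: "recf \<Rightarrow> nat list \<Rightarrow> nat \<Rightarrow> bool" where
  zero: "eval_recf Zero xs 0"
| succ: "eval_recf Succ (x # xs) (Suc x)"
| proj: "i < length xs \<Longrightarrow> eval_recf (Proj i) xs (xs ! i)"
| comp: "length ys = length gs \<Longrightarrow> (\<forall>i < length gs. eval_recf (gs ! i) xs (ys ! i))
          \<Longrightarrow> eval_recf f ys z \<Longrightarrow> eval_recf (Comp f gs) xs z"
| pr0: "eval_recf f xs y \<Longrightarrow> eval_recf (PrimRec f g) (0 # xs) y"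
| prS: "eval_recf (PrimRec f g) (n # xs) z \<Longrightarrow> eval_recf g (z # n # xs) y
          \<Longrightarrow> eval_recf (PrimRec f g) (Suc n # xs) y"
| mu: "eval_recf f (n # xs) 0 \<Longrightarrow> (\<forall>m < n. \<exists>z. eval_recf f (m # xs) z \<and> z \<noteq> 0)
          \<Longrightarrow> eval_recf (Mu f) xs n"

definition computable1 :: "(nat \<Rightarrow> nat) \<Rightarrow> bool" where
  "computable1 h \<longleftrightarrow> (\<exists>e. \<forall>x. eval_recf e [x] (h x))"

definition computable2 :: "(nat \<Rightarrow> nat \<Rightarrow> nat) \<Rightarrow> bool" where
  "computable2 R \<longleftrightarrow> (\<exists>e. \<forall>a b. eval_recf e [a, b] (R a b))"

text \<open>Kleene normal form: A is Sigma^1_1 iff n in A <-> exists alpha, forall m,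
  R(n, code of alpha restricted to [0,m)) = 0, for a computable R.\<close>
definition Sigma11 :: "nat set \<Rightarrow> bool" where
  "Sigma11 A \<longleftrightarrow> (\<exists>R. computable2 R \<and>
     (\<forall>n. n \<in> A \<longleftrightarrow> (\<exists>\<alpha> :: nat \<Rightarrow> nat. \<forall>m. R n (list_encode (map \<alpha> [0..<m])) = 0)))"

definition Sigma11_hard :: "nat set \<Rightarrow> bool" where
  "Sigma11_hard B \<longleftrightarrow> (\<forall>A. Sigma11 A \<longrightarrow> (\<exists>g. computable1 g \<and> (\<forall>n. n \<in> A \<longleftrightarrow> g n \<in> B)))"

type_synonym vertex = "int \<times> int"

definition Delta :: "vertex list" where
  "Delta = [(1,0), (-1,0), (0,1), (0,-1)]"

definition edges :: "vertex \<Rightarrow> (vertex \<times> vertex) set" where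
  "edges \<delta> = {(z, (fst z + fst \<delta>, snd z + snd \<delta>)) | z. True}"

fun reach :: "vertex list \<Rightarrow> vertex \<Rightarrow> vertex set" where
  "reach [] v = {v}"
| "reach (\<delta> # w) v = (\<Union>v' \<in> {v'. (v, v') \<in> edges \<delta>}. reach w v')"

definition words_upto :: "nat \<Rightarrow> vertex list list" where
  "words_upto r = concat (map (\<lambda>l. List.n_lists l Delta) [0..<Suc r])"

definition pattern :: "nat \<Rightarrow> (vertex \<Rightarrow> nat) \<Rightarrow> vertex \<Rightarrow> nat \<Rightarrow> nat \<Rightarrow> (vertex list \<times> nat \<Rightarrow> nat)" where
  "pattern n c v r k = (\<lambda>(w, s). if w \<in> set (words_upto r) \<and> s < n
      then min k (card {v' \<in> reach w v. c v' = s}) else 0)"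

text \<open>Encoding of local rules: a code c decodes to [n, r, k, t] where the state set is
  {0..<n}, r the radius, k the cap, and t (list-encoded) is the table of f, indexed
  by the mixed-radix number of a multiset with respect to the canonical list of
  Delta^{<=r} x S.\<close>
definition dom_list :: "nat \<Rightarrow> nat \<Rightarrow> (vertex list \<times> nat) list" where
  "dom_list n r = List.product (words_upto r) [0..<n]"

definition ms_index :: "nat \<Rightarrow> nat \<Rightarrow> nat \<Rightarrow> (vertex list \<times> nat \<Rightarrow> nat) \<Rightarrow> nat" where
  "ms_index n r k m = (\<Sum>i < length (dom_list n r). m (dom_list n r ! i) * (Suc k) ^ i)"

definition code_states :: "nat \<Rightarrow> nat" where "code_states c = list_decode c ! 0"
definition code_radius :: "nat \<Rightarrow> nat" where "code_radius c = list_decode c ! 1"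
definition code_cap :: "nat \<Rightarrow> nat" where "code_cap c = list_decode c ! 2"
definition code_table :: "nat \<Rightarrow> nat list" where "code_table c = list_decode (list_decode c ! 3)"

definition valid_rule_code :: "nat \<Rightarrow> bool" where
  "valid_rule_code c \<longleftrightarrow> length (list_decode c) = 4 \<and> code_states c \<ge> 1 \<and> code_cap c \<ge> 1
     \<and> length (code_table c) = Suc (code_cap c) ^ length (dom_list (code_states c) (code_radius c))
     \<and> (\<forall>x \<in> set (code_table c). x < code_states c)"

definition local_rule :: "nat \<Rightarrow> (vertex list \<times> nat \<Rightarrow> nat) \<Rightarrow> nat" where
  "local_rule c m = code_table c ! ms_index (code_states c) (code_radius c) (code_cap c) m"

definition global_map :: "nat \<Rightarrow> (vertex \<Rightarrow> nat) \<Rightarrow> (vertex \<Rightarrow> nat)" where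
  "global_map c x = (\<lambda>v. local_rule c (pattern (code_states c) x v (code_radius c) (code_cap c)))"

definition is_config :: "nat \<Rightarrow> (vertex \<Rightarrow> nat) \<Rightarrow> bool" where
  "is_config n x \<longleftrightarrow> (\<forall>v. x v < n)"

definition satisfies_phi :: "nat \<Rightarrow> bool" where
  "satisfies_phi c \<longleftrightarrow> (let n = code_states c; F = global_map c in
     \<exists>y. is_config n y \<and> F y = y \<and>
       (\<forall>y' y1 y2 y3. is_config n y' \<and> is_config n y1 \<and> is_config n y2 \<and> is_config n y3 \<longrightarrow>
          (y' \<noteq> y \<and> F y' = y \<and> F y1 = y' \<and> F y2 = y' \<and> F y3 = y') \<longrightarrow>
          (y1 = y2 \<or> y1 = y3 \<or> y2 = y1 \<or> y2 = y3 \<or> y3 = y1 \<or> y3 = y2)))"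

end

theory Submission
  imports Defs
begin

text \<open>
  A \<open>\<Sigma>\<^sup>1\<^sub>1\<close> set is the set of \<open>n\<close> such that some infinite chain of numbers, each one a computably checkable
  extension of its predecessor, exists. A counter machine started on \<open>n\<close> builds such a chain by
  guessing the next number in unary and checking it, getting stuck on a wrong guess, so membership
  means that the machine has an infinite run which does not stay forever in one guessing loop.

  Space-time diagrams of the machine (registers in unary along rows, time upwards) are the tilings
  of a quadrant below and left of which nothing happens; the cellular automaton turns every cell that
  sees a tiling error into an error state, and error states flip forever, so fixed points are exactly the
  correct tilings. A cell may also carry a mark with a stage. One step takes the stages 1, 2, 3 to
  stage 0, and erases marks of stage 0. Hence a fixed point with a legal nonempty marking has a
  preimage different from itself (the marking at stage 0) with three preimages, whereas without
  such a marking no point other than the fixed point itself is a preimage of it and in the image of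
  the map. Legal markings are designed to exist exactly when the tiling has no seed (then
  everything can be marked) or when the machine guesses forever from some time on (then that half
  column can be marked).
\<close>

section \<open>Computable functions\<close>

text \<open>The space of configurations is compact, so limits of tilings are tilings, and these
  tilings cannot by themselves force a seed to occur or a guess to end: limits taken far away from
  the seed, or along ever longer guesses, violate the demand. The existence of a fixed point alone
  is only a co-enumerable condition. Both demands are therefore left to the inner universal
  quantifier: a violation is exactly room for an infinite marking, which the formula sees as a
  preimage \<open>y'\<close>. There are three nonzero stages because the formula tolerates two
  preimages. Asking for preimages of \<open>y'\<close> has a second use: unmarked cells may carry a
  stage too, which gives the fixed point further preimages, but these have nonzero stages and hence
  no preimage themselves. The input is put into the number of states. This keeps the program and the
  tiles fixed and reduces the dependence of the rule on \<open>n\<close> to comparisons of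
  numbers.\<close>

text \<open>The arity is explicit because \<open>recf\<close> terms act on lists of any length.
  Closure rules for functions of the whole list let computability be derived along the syntax of a
  term.\<close>

definition rec_fun :: "nat \<Rightarrow> (nat list \<Rightarrow> nat) \<Rightarrow> bool" where
  "rec_fun k f \<longleftrightarrow> (\<exists>e. \<forall>xs. length xs = k \<longrightarrow> eval_recf e xs (f xs))"

definition rec_pred :: "nat \<Rightarrow> (nat list \<Rightarrow> bool) \<Rightarrow> bool" where
  "rec_pred k P \<longleftrightarrow> rec_fun k (\<lambda>xs. of_bool (P xs))"

lemma rec_fun_cong:
  assumes "rec_fun k f" "\<And>xs. length xs = k \<Longrightarrow> f xs = g xs"
  shows "rec_fun k g"
  using assms unfolding rec_fun_def by metis

lemma rec_fun_proj: "i < k \<Longrightarrow> rec_fun k (\<lambda>xs. xs ! i)"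
  unfolding rec_fun_def by (intro exI[of _ "Proj i"]) (auto intro: eval_recf.proj)

lemma rec_fun_comp:
  assumes "rec_fun (length gs) f" "\<And>g. g \<in> set gs \<Longrightarrow> rec_fun k g"
  shows "rec_fun k (\<lambda>xs. f (map (\<lambda>g. g xs) gs))"
proof -
  obtain e where e: "\<And>xs. length xs = length gs \<Longrightarrow> eval_recf e xs (f xs)"
    using assms(1) unfolding rec_fun_def by blast
  have "\<forall>g\<in>set gs. \<exists>e. \<forall>xs. length xs = k \<longrightarrow> eval_recf e xs (g xs)"
    using assms(2) unfolding rec_fun_def by blast
  then obtain E where E: "\<And>g xs. g \<in> set gs \<Longrightarrow> length xs = k \<Longrightarrow> eval_recf (E g) xs (g xs)"
    by (metis bchoice)
  have "eval_recf (Comp e (map E gs)) xs (f (map (\<lambda>g. g xs) gs))" if "length xs = k" for xs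
    by (rule eval_recf.comp[where ys = "map (\<lambda>g. g xs) gs"]) (use that e E in auto)
  then show ?thesis unfolding rec_fun_def by blast
qed

lemma rec_fun_drop:
  assumes "rec_fun k f" "n = m + k"
  shows "rec_fun n (\<lambda>ys. f (drop m ys))"
proof -
  have "rec_fun n (\<lambda>ys. f (map (\<lambda>g. g ys) (map (\<lambda>i ys. ys ! (m + i)) [0..<k])))"
    by (rule rec_fun_comp) (use assms in \<open>auto intro: rec_fun_proj\<close>)
  then show ?thesis
    by (rule rec_fun_cong) (use assms(2) in \<open>auto intro!: arg_cong[of _ _ f] nth_equalityI\<close>)
qed

lemma rec_fun_drop1: "rec_fun k f \<Longrightarrow> rec_fun (Suc k) (\<lambda>ys. f (drop 1 ys))"
  by (rule rec_fun_drop) auto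

lemma rec_fun_drop2: "rec_fun k f \<Longrightarrow> rec_fun (Suc (Suc k)) (\<lambda>ys. f (drop 2 ys))"
  by (rule rec_fun_drop) auto

lemma rec_fun_nth_drop: "m + i < k \<Longrightarrow> rec_fun k (\<lambda>xs. drop m xs ! i)"
  by (rule rec_fun_cong[OF rec_fun_proj[of "m + i"]]) auto

lemma computable1_iff: "computable1 h \<longleftrightarrow> rec_fun 1 (\<lambda>xs. h (xs ! 0))"
proof -
  have "(\<forall>x. eval_recf e [x] (h x)) \<longleftrightarrow> (\<forall>xs. length xs = 1 \<longrightarrow> eval_recf e xs (h (xs ! 0)))" for e
    by (metis One_nat_def length_0_conv length_Cons length_Suc_conv nth_Cons_0)
  then show ?thesis unfolding rec_fun_def computable1_def by simp
qed

lemma computable2_iff: "computable2 h \<longleftrightarrow> rec_fun 2 (\<lambda>xs. h (xs ! 0) (xs ! 1))"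
proof -
  have "(\<exists>a b. xs = [a, b])" if "length xs = 2" for xs :: "nat list"
    using that by (auto simp: length_Suc_conv numeral_2_eq_2)
  then have "(\<forall>a b. eval_recf e [a, b] (h a b)) \<longleftrightarrow>
      (\<forall>xs. length xs = 2 \<longrightarrow> eval_recf e xs (h (xs ! 0) (xs ! 1)))" for e
    by (metis One_nat_def length_Cons list.size(3) nth_Cons_0 nth_Cons_Suc numeral_2_eq_2)
  then show ?thesis unfolding rec_fun_def computable2_def by simp
qed

lemma rec_fun_comp1:
  assumes "computable1 h" "rec_fun k f"
  shows "rec_fun k (\<lambda>xs. h (f xs))"
proof -
  have "rec_fun 1 (\<lambda>xs. h (xs ! 0))"
    using assms(1) unfolding computable1_iff .
  then show ?thesis
    using rec_fun_comp[of "[f]" "\<lambda>xs. h (xs ! 0)" k] assms(2) by auto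
qed

lemma rec_fun_comp2:
  assumes "computable2 h" "rec_fun k f" "rec_fun k g"
  shows "rec_fun k (\<lambda>xs. h (f xs) (g xs))"
proof -
  have "rec_fun 2 (\<lambda>xs. h (xs ! 0) (xs ! 1))"
    using assms(1) unfolding computable2_iff .
  then show ?thesis
    using rec_fun_comp[of "[f,g]" "\<lambda>xs. h (xs ! 0) (xs ! 1)" k] assms(2,3) by (auto simp: numeral_2_eq_2)
qed

lemma rec_fun_Suc:
  assumes "rec_fun k f"
  shows "rec_fun k (\<lambda>xs. Suc (f xs))"
proof (rule rec_fun_comp1[OF _ assms])
  show "computable1 Suc"
    unfolding computable1_def by (intro exI[of _ Succ] allI eval_recf.succ)
qed

lemma rec_fun_const: "rec_fun k (\<lambda>_. c)"
proof (induction c)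
  case 0
  show ?case unfolding rec_fun_def by (intro exI[of _ Zero]) (auto intro: eval_recf.zero)
qed (rule rec_fun_Suc)

text \<open>\<open>PrimRec\<close> passes the previous value before the counter, which fixes the
  roles of \<open>ys ! 0\<close> and \<open>ys ! 1\<close>. It recurses on its first argument;
  composing with \<open>a\<close> followed by all projections allows any computable bound.\<close>

lemma rec_fun_rec:
  assumes b: "rec_fun k b" and h: "rec_fun (Suc (Suc k)) (\<lambda>ys. h (ys ! 1) (ys ! 0) (drop 2 ys))"
    and a: "rec_fun k a"
  shows "rec_fun k (\<lambda>xs. rec_nat (b xs) (\<lambda>m r. h m r xs) (a xs))"
proof -
  obtain eb where eb: "\<And>xs. length xs = k \<Longrightarrow> eval_recf eb xs (b xs)"
    using b unfolding rec_fun_def by blast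
  obtain eh where eh: "\<And>ys. length ys = Suc (Suc k) \<Longrightarrow> eval_recf eh ys (h (ys ! 1) (ys ! 0) (drop 2 ys))"
    using h unfolding rec_fun_def by blast
  have *: "eval_recf (PrimRec eb eh) (n # xs) (rec_nat (b xs) (\<lambda>m r. h m r xs) n)"
    if "length xs = k" for n xs
  proof (induction n)
    case 0
    show ?case using eb that by (auto intro: eval_recf.pr0)
  next
    case (Suc n)
    show ?case
      by (rule eval_recf.prS[OF Suc])
        (use eh[of "rec_nat (b xs) (\<lambda>m r. h m r xs) n # n # xs"] that in simp)
  qed
  have "rec_fun (Suc k) (\<lambda>ys. rec_nat (b (tl ys)) (\<lambda>m r. h m r (tl ys)) (hd ys))"
    unfolding rec_fun_def
    by (intro exI[of _ "PrimRec eb eh"]) (use * in \<open>auto simp: length_Suc_conv\<close>)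
  then have "rec_fun k (\<lambda>xs. (\<lambda>ys. rec_nat (b (tl ys)) (\<lambda>m r. h m r (tl ys)) (hd ys))
      (map (\<lambda>g. g xs) (a # map (\<lambda>i xs. xs ! i) [0..<k])))"
    by (intro rec_fun_comp) (auto intro: rec_fun_proj a)
  then show ?thesis
  proof (rule rec_fun_cong)
    fix xs :: "nat list"
    assume "length xs = k"
    then have "map (\<lambda>g. g xs) (map (\<lambda>i xs. xs ! i) [0..<k]) = xs"
      by (auto intro!: nth_equalityI)
    then show "(\<lambda>ys. rec_nat (b (tl ys)) (\<lambda>m r. h m r (tl ys)) (hd ys))
        (map (\<lambda>g. g xs) (a # map (\<lambda>i xs. xs ! i) [0..<k])) = rec_nat (b xs) (\<lambda>m r. h m r xs) (a xs)"
      by simp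
  qed
qed

text \<open>\<open>Mu\<close> may diverge, so only searches known to succeed are covered. It looks
  for a zero, hence the complement of the predicate.\<close>

lemma rec_pred_Least:
  assumes P: "rec_pred (Suc k) (\<lambda>ys. P (ys ! 0) (drop 1 ys))"
    and ex: "\<And>xs. length xs = k \<Longrightarrow> \<exists>m. P m xs"
  shows "rec_fun k (\<lambda>xs. LEAST m. P m xs)"
proof -
  have "rec_fun (Suc k) (\<lambda>ys. rec_nat 1 (\<lambda>_ _. 0) (of_bool (P (ys ! 0) (drop 1 ys))))"
    by (intro rec_fun_rec rec_fun_const P[unfolded rec_pred_def])
  then have "rec_fun (Suc k) (\<lambda>ys. of_bool (\<not> P (ys ! 0) (drop 1 ys)))"
    by (rule rec_fun_cong) auto
  then obtain e where e: "\<And>ys. length ys = Suc k \<Longrightarrow>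
      eval_recf e ys (of_bool (\<not> P (ys ! 0) (drop 1 ys)))"
    unfolding rec_fun_def by blast
  have "eval_recf (Mu e) xs (LEAST m. P m xs)" if len: "length xs = k" for xs
  proof (rule eval_recf.mu)
    have "P (LEAST m. P m xs) xs" using ex[OF len] by (rule LeastI_ex)
    then show "eval_recf e ((LEAST m. P m xs) # xs) 0"
      using e[of "(LEAST m. P m xs) # xs"] len by simp
    show "\<forall>m<(LEAST m. P m xs). \<exists>z. eval_recf e (m # xs) z \<and> z \<noteq> 0"
    proof (intro allI impI)
      fix m assume "m < (LEAST m. P m xs)"
      then have "\<not> P m xs" by (rule not_less_Least)
      then show "\<exists>z. eval_recf e (m # xs) z \<and> z \<noteq> 0"
        using e[of "m # xs"] len by (intro exI[of _ 1]) simp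
    qed
  qed
  then show ?thesis unfolding rec_fun_def by blast
qed

lemma rec_fun_if:
  assumes "rec_pred k P" "rec_fun k f" "rec_fun k g"
  shows "rec_fun k (\<lambda>xs. if P xs then f xs else g xs)"
proof -
  have "rec_fun k (\<lambda>xs. rec_nat (g xs) (\<lambda>_ _. f xs) (of_bool (P xs)))"
    by (intro rec_fun_rec rec_fun_drop2[OF assms(2)] assms assms(1)[unfolded rec_pred_def])
  then show ?thesis by (rule rec_fun_cong) auto
qed

lemma rec_pred_eq_0: "rec_fun k f \<Longrightarrow> rec_pred k (\<lambda>xs. f xs = 0)"
  unfolding rec_pred_def
  by (rule rec_fun_cong[OF rec_fun_rec[of k "\<lambda>_. 1" "\<lambda>_ _ _. 0" f]])
    (auto intro: rec_fun_const simp: gr0_conv_Suc)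

lemma rec_pred_not: "rec_pred k P \<Longrightarrow> rec_pred k (\<lambda>xs. \<not> P xs)"
  unfolding rec_pred_def by (rule rec_fun_cong[OF rec_fun_if[of k P "\<lambda>_. 0" "\<lambda>_. 1"]])
    (auto intro: rec_fun_const simp: rec_pred_def)

lemma rec_pred_conj: "rec_pred k P \<Longrightarrow> rec_pred k Q \<Longrightarrow> rec_pred k (\<lambda>xs. P xs \<and> Q xs)"
  unfolding rec_pred_def
  by (rule rec_fun_cong[OF rec_fun_if[of k P "\<lambda>xs. of_bool (Q xs)" "\<lambda>_. 0"]])
    (auto intro: rec_fun_const simp: rec_pred_def)

lemma rec_pred_disj:
  assumes "rec_pred k P" "rec_pred k Q"
  shows "rec_pred k (\<lambda>xs. P xs \<or> Q xs)"
  using rec_pred_not[OF rec_pred_conj[OF rec_pred_not[OF assms(1)] rec_pred_not[OF assms(2)]]] by simp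

lemma rec_pred_imp:
  assumes "rec_pred k P" "rec_pred k Q"
  shows "rec_pred k (\<lambda>xs. P xs \<longrightarrow> Q xs)"
  using rec_pred_disj[OF rec_pred_not[OF assms(1)] assms(2)] unfolding imp_conv_disj .

section \<open>Arithmetic, bounded search, pairing and lists\<close>

lemma rec_fun_pred: "rec_fun k f \<Longrightarrow> rec_fun k (\<lambda>xs. f xs - 1)"
proof (rule rec_fun_cong[OF rec_fun_rec[of k "\<lambda>_. 0" "\<lambda>m _ _. m" f]])
  show "rec_nat 0 (\<lambda>m r. m) (f xs) = f xs - 1" for xs by (cases "f xs") auto
qed (auto intro: rec_fun_const rec_fun_proj)

lemma rec_fun_add:
  assumes "rec_fun k f" "rec_fun k g"
  shows "rec_fun k (\<lambda>xs. f xs + g xs)"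
proof (rule rec_fun_cong[OF rec_fun_rec[of k f "\<lambda>_ r _. Suc r" g]])
  have "rec_nat a (\<lambda>m. Suc) b = a + b" for a b :: nat by (induction b) auto
  then show "rec_nat (f xs) (\<lambda>m r. Suc r) (g xs) = f xs + g xs" for xs by simp
qed (auto intro: assms rec_fun_Suc rec_fun_proj)


lemma rec_fun_diff:
  assumes "rec_fun k f" "rec_fun k g"
  shows "rec_fun k (\<lambda>xs. f xs - g xs)"
proof (rule rec_fun_cong[OF rec_fun_rec[of k f "\<lambda>_ r _. r - 1" g]])
  have "rec_nat a (\<lambda>m r. r - 1) b = a - b" for a b :: nat by (induction b) auto
  then show "rec_nat (f xs) (\<lambda>m r. r - 1) (g xs) = f xs - g xs" for xs by simp
qed (auto intro: assms rec_fun_pred[unfolded One_nat_def] rec_fun_proj)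

lemma rec_fun_mult:
  assumes "rec_fun k f" "rec_fun k g"
  shows "rec_fun k (\<lambda>xs. f xs * g xs)"
proof (rule rec_fun_cong[OF rec_fun_rec[of k "\<lambda>_. 0" "\<lambda>_ r xs. f xs + r" g]])
  have "rec_nat 0 (\<lambda>m r. a + r) b = a * b" for a b :: nat by (induction b) auto
  then show "rec_nat 0 (\<lambda>m r. f xs + r) (g xs) = f xs * g xs" for xs by simp
qed (intro assms rec_fun_drop2[OF assms(1)] rec_fun_add rec_fun_proj rec_fun_const; simp)+

lemma rec_fun_power:
  assumes "rec_fun k f" "rec_fun k g"
  shows "rec_fun k (\<lambda>xs. f xs ^ g xs)"
proof (rule rec_fun_cong[OF rec_fun_rec[of k "\<lambda>_. 1" "\<lambda>_ r xs. f xs * r" g]])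
  have "rec_nat 1 (\<lambda>m r. a * r) b = a ^ b" for a b :: nat by (induction b) auto
  then show "rec_nat 1 (\<lambda>m r. f xs * r) (g xs) = f xs ^ g xs" for xs by simp
qed (intro assms rec_fun_drop2[OF assms(1)] rec_fun_mult rec_fun_proj rec_fun_const; simp)+

lemma rec_pred_le: "rec_fun k f \<Longrightarrow> rec_fun k g \<Longrightarrow> rec_pred k (\<lambda>xs. f xs \<le> g xs)"
  using rec_pred_eq_0[OF rec_fun_diff[of k f g]] by simp

lemma rec_pred_less: "rec_fun k f \<Longrightarrow> rec_fun k g \<Longrightarrow> rec_pred k (\<lambda>xs. f xs < g xs)"
  using rec_pred_not[OF rec_pred_le[of k g f]] by (simp add: not_le)

lemma rec_pred_eq: "rec_fun k f \<Longrightarrow> rec_fun k g \<Longrightarrow> rec_pred k (\<lambda>xs. f xs = g xs)"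
  using rec_pred_conj[OF rec_pred_le[of k f g] rec_pred_le[of k g f]] by (simp add: eq_iff)

lemma rec_pred_cong:
  assumes "rec_pred k P" "\<And>xs. length xs = k \<Longrightarrow> P xs \<longleftrightarrow> Q xs"
  shows "rec_pred k Q"
  using assms(1) unfolding rec_pred_def by (rule rec_fun_cong) (use assms(2) in auto)

text \<open>The quotient is the least \<open>q\<close> with \<open>f xs < Suc q * g xs\<close>. The
  disjunct \<open>g xs = 0\<close> only makes the search total; the conditional returns 0 for
  division by zero.\<close>

lemma rec_fun_div:
  assumes "rec_fun k f" "rec_fun k g"
  shows "rec_fun k (\<lambda>xs. f xs div g xs)"
proof -
  have "rec_fun k (\<lambda>xs. if g xs = 0 then 0 else LEAST q. f xs < Suc q * g xs \<or> g xs = 0)"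
  proof (intro rec_fun_if rec_pred_eq_0 rec_fun_const assms rec_pred_Least rec_pred_disj
      rec_pred_less rec_fun_mult rec_fun_Suc)
    show "\<exists>q. f xs < Suc q * g xs \<or> g xs = 0" for xs
      by (cases "g xs") (auto intro!: exI[of _ "f xs"])
  qed (intro rec_fun_proj rec_fun_drop1[OF assms(1)] rec_fun_drop1[OF assms(2)]
      rec_fun_const rec_fun_Suc assms; simp)+
  then show ?thesis
  proof (rule rec_fun_cong)
    fix xs
    have "(LEAST q. a < Suc q * b) = a div b" if "b > 0" for a b :: nat
    proof (rule Least_equality)
      show "a < Suc (a div b) * b" using that by (simp add: dividend_less_div_times)
      show "a div b \<le> q" if "a < Suc q * b" for q
        using that by (simp add: less_Suc_eq_le[symmetric] less_mult_imp_div_less del: mult_Suc)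
    qed
    then show "(if g xs = 0 then 0 else LEAST q. f xs < Suc q * g xs \<or> g xs = 0) = f xs div g xs"
      by (auto simp del: mult_Suc)
  qed
qed

lemma rec_pred_odd:
  assumes "rec_fun k f"
  shows "rec_pred k (\<lambda>xs. odd (f xs))"
proof (rule rec_pred_cong[OF rec_pred_not[OF rec_pred_eq[OF assms
    rec_fun_mult[OF rec_fun_const[of k 2] rec_fun_div[OF assms rec_fun_const[of k 2]]]]]])
  show "(f xs \<noteq> 2 * (f xs div 2)) = odd (f xs)" for xs by presburger
qed

text \<open>The search becomes total by letting it also stop above the bound; where it stopped tells
  whether a witness exists.\<close>

lemma rec_pred_ex_le:
  assumes P: "rec_pred (Suc k) (\<lambda>ys. P (ys ! 0) (drop 1 ys))" and b: "rec_fun k b"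
  shows "rec_pred k (\<lambda>xs. \<exists>m\<le>b xs. P m xs)"
proof (rule rec_pred_cong)
  show "rec_pred k (\<lambda>xs. (LEAST m. P m xs \<or> b xs < m) \<le> b xs)"
    by (intro rec_pred_le rec_pred_Least rec_pred_disj P rec_pred_less rec_fun_proj b
        rec_fun_drop[OF b]) (auto intro: exI[of _ "Suc n" for n])
  fix xs
  show "((LEAST m. P m xs \<or> b xs < m) \<le> b xs) = (\<exists>m\<le>b xs. P m xs)"
  proof
    let ?l = "LEAST m. P m xs \<or> b xs < m"
    have "P ?l xs \<or> b xs < ?l" by (rule LeastI[of _ "Suc (b xs)"]) simp
    then show "?l \<le> b xs \<Longrightarrow> \<exists>m\<le>b xs. P m xs" by auto
    assume "\<exists>m\<le>b xs. P m xs"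
    then obtain m where "m \<le> b xs" "P m xs" by blast
    moreover from this have "?l \<le> m" by (intro Least_le) simp
    ultimately show "?l \<le> b xs" by simp
  qed
qed

lemma rec_fun_triangle:
  assumes "rec_fun k f"
  shows "rec_fun k (\<lambda>xs. triangle (f xs))"
  unfolding triangle_def by (intro rec_fun_div rec_fun_mult rec_fun_Suc rec_fun_const assms)

lemma rec_fun_prod_encode:
  assumes "rec_fun k f" "rec_fun k g"
  shows "rec_fun k (\<lambda>xs. prod_encode (f xs, g xs))"
  unfolding prod_encode_def prod.case by (intro rec_fun_add rec_fun_triangle assms)

lemma rec_fun_fst_prod_decode:
  assumes "rec_fun k f"
  shows "rec_fun k (\<lambda>xs. fst (prod_decode (f xs)))"
proof (rule rec_fun_cong)
  show "rec_fun k (\<lambda>xs. LEAST a. \<exists>b\<le>f xs. prod_encode (a, b) = f xs)"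
  proof (intro rec_pred_Least rec_pred_ex_le rec_pred_eq rec_fun_prod_encode)
    fix xs
    obtain a b where ab: "f xs = prod_encode (a, b)" by (metis prod_decode_inverse surj_pair)
    then show "\<exists>a. \<exists>b\<le>f xs. prod_encode (a, b) = f xs" by (auto simp: le_prod_encode_2)
  qed (intro rec_fun_drop1[OF assms] rec_fun_drop1[OF rec_fun_drop1[OF assms]]
      rec_fun_proj rec_fun_nth_drop; simp)+
  fix xs
  obtain a b where ab: "f xs = prod_encode (a, b)" by (metis prod_decode_inverse surj_pair)
  then show "(LEAST a. \<exists>b\<le>f xs. prod_encode (a, b) = f xs) = fst (prod_decode (f xs))"
    by (auto intro!: Least_equality simp: le_prod_encode_2)
qed

lemma rec_fun_snd_prod_decode:
  assumes "rec_fun k f"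
  shows "rec_fun k (\<lambda>xs. snd (prod_decode (f xs)))"
proof (rule rec_fun_cong)
  show "rec_fun k (\<lambda>xs. LEAST b. \<exists>a\<le>f xs. prod_encode (a, b) = f xs)"
  proof (intro rec_pred_Least rec_pred_ex_le rec_pred_eq rec_fun_prod_encode)
    fix xs
    obtain a b where ab: "f xs = prod_encode (a, b)" by (metis prod_decode_inverse surj_pair)
    then show "\<exists>b. \<exists>a\<le>f xs. prod_encode (a, b) = f xs" by (auto simp: le_prod_encode_1)
  qed (intro rec_fun_drop1[OF assms] rec_fun_drop1[OF rec_fun_drop1[OF assms]]
      rec_fun_proj rec_fun_nth_drop; simp)+
  fix xs
  obtain a b where ab: "f xs = prod_encode (a, b)" by (metis prod_decode_inverse surj_pair)
  then show "(LEAST b. \<exists>a\<le>f xs. prod_encode (a, b) = f xs) = snd (prod_decode (f xs))"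
    by (auto intro!: Least_equality simp: le_prod_encode_1)
qed

text \<open>A list code is built by consing, thus from the last element: after \<open>j\<close>
  rounds the accumulator codes the last \<open>j\<close> entries, which is where the index
  \<open>b xs - Suc m\<close> comes from.\<close>

lemma rec_fun_list_encode_map:
  assumes f: "rec_fun (Suc k) (\<lambda>ys. f (ys ! 0) (drop 1 ys))" and b: "rec_fun k b"
  shows "rec_fun k (\<lambda>xs. list_encode (map (\<lambda>i. f i xs) [0..<b xs]))"
proof (rule rec_fun_cong)
  let ?h = "\<lambda>m r xs. Suc (prod_encode (f (b xs - Suc m) xs, r))"
  have "rec_fun (Suc (Suc k)) (\<lambda>ys. (\<lambda>zs. f (zs ! 0) (drop 1 zs))
      (map (\<lambda>g. g ys) ((\<lambda>ys. b (drop 2 ys) - Suc (ys ! 1)) # map (\<lambda>i ys. ys ! (2 + i)) [0..<k])))"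
    by (rule rec_fun_comp)
      (use f rec_fun_diff[OF rec_fun_drop2[OF b] rec_fun_Suc[OF rec_fun_proj[of 1]]] in \<open>auto intro: rec_fun_proj\<close>)
  then have "rec_fun (Suc (Suc k)) (\<lambda>ys. f (b (drop 2 ys) - Suc (ys ! 1)) (drop 2 ys))"
  proof (rule rec_fun_cong)
    fix ys :: "nat list"
    assume "length ys = Suc (Suc k)"
    then have "map (\<lambda>g. g ys) (map (\<lambda>i ys. ys ! (2 + i)) [0..<k]) = drop 2 ys"
      by (auto intro!: nth_equalityI)
    then show "(\<lambda>zs. f (zs ! 0) (drop 1 zs))
      (map (\<lambda>g. g ys) ((\<lambda>ys. b (drop 2 ys) - Suc (ys ! 1)) # map (\<lambda>i ys. ys ! (2 + i)) [0..<k]))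
      = f (b (drop 2 ys) - Suc (ys ! 1)) (drop 2 ys)" by simp
  qed
  then show "rec_fun k (\<lambda>xs. rec_nat 0 (\<lambda>m r. ?h m r xs) (b xs))"
    by (intro rec_fun_rec rec_fun_const b rec_fun_Suc rec_fun_prod_encode) (auto intro: rec_fun_proj)
  fix xs
  have "j \<le> b xs \<Longrightarrow> rec_nat 0 (\<lambda>m r. ?h m r xs) j = list_encode (map (\<lambda>i. f i xs) [b xs - j..<b xs])" for j
  proof (induction j)
    case (Suc j)
    then have "[b xs - Suc j..<b xs] = (b xs - Suc j) # [b xs - j..<b xs]"
      by (simp add: upt_rec[of "b xs - Suc j"] Suc_diff_Suc)
    with Suc show ?case by simp
  qed simp
  from this[of "b xs"] show "rec_nat 0 (\<lambda>m r. ?h m r xs) (b xs)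
      = list_encode (map (\<lambda>i. f i xs) [0..<b xs])" by simp
qed

text \<open>Makes every finite table computable, whatever its entries; the part of the local rule
  that does not depend on the input is such a table.\<close>

lemma rec_fun_finite_support:
  assumes "finite S" "\<And>l. l \<in> S \<Longrightarrow> length l = k"
  shows "rec_fun k (\<lambda>xs. if xs \<in> S then h xs else 0)"
  using assms
proof (induction S rule: finite_induct)
  case empty
  show ?case using rec_fun_const[of k 0] by simp
next
  case (insert l S)
  have *: "m \<le> k \<Longrightarrow> rec_pred k (\<lambda>xs. \<forall>i<m. xs ! i = l ! i)" for m
  proof (induction m)
    case 0
    show ?case unfolding rec_pred_def using rec_fun_const[of k 1] by simp
  next
    case (Suc m)
    then have "rec_pred k (\<lambda>xs. (\<forall>i<m. xs ! i = l ! i) \<and> xs ! m = l ! m)"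
      by (intro rec_pred_conj rec_pred_eq rec_fun_proj rec_fun_const) auto
    then show ?case by (rule rec_pred_cong) (auto simp: less_Suc_eq)
  qed
  have "length l = k" using insert.prems by simp
  have "rec_pred k (\<lambda>xs. xs = l)"
    by (rule rec_pred_cong[OF *[of k]]) (simp_all add: list_eq_iff_nth_eq \<open>length l = k\<close>)
  then have "rec_fun k (\<lambda>xs. if xs = l then h l else if xs \<in> S then h xs else 0)"
    by (rule rec_fun_if[OF _ rec_fun_const]) (use insert in auto)
  then show ?case by (rule rec_fun_cong) auto
qed

section \<open>Counter programs\<close>

datatype com = Inc nat | Dec nat | Wh nat "com list" | Guess nat

type_synonym conf = "com list \<times> (nat \<Rightarrow> nat)"

text \<open>The control point of a running program is its continuation, the list of commands still to be executed.
  \<open>Guess\<close>, the only nondeterministic command, has no rule here: it increments its register any positive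
  number of times.\<close>

inductive dstep :: "conf \<Rightarrow> conf \<Rightarrow> bool" where
  "dstep (Inc r # k, s) (k, s(r := Suc (s r)))"
| "dstep (Dec r # k, s) (k, s(r := s r - 1))"
| "s r = 0 \<Longrightarrow> dstep (Wh r p # k, s) (k, s)"
| "s r \<noteq> 0 \<Longrightarrow> dstep (Wh r p # k, s) (p @ Wh r p # k, s)"

text \<open>Quantifying over the continuation makes execution compositional: a block behaves the
  same inside any program.\<close>

definition runs :: "com list \<Rightarrow> (nat \<Rightarrow> nat) \<Rightarrow> (nat \<Rightarrow> nat) \<Rightarrow> bool" where
  "runs p s s' \<longleftrightarrow> (\<forall>k. dstep\<^sup>*\<^sup>* (p @ k, s) (k, s'))"

lemma runs_Nil: "runs [] s s"
  unfolding runs_def by simp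

lemma runs_append: "runs p s s' \<Longrightarrow> runs q s' s'' \<Longrightarrow> runs (p @ q) s s''"
  unfolding runs_def by (metis append_assoc rtranclp_trans)

lemma runs_Cons: "runs [c] s s' \<Longrightarrow> runs q s' s'' \<Longrightarrow> runs (c # q) s s''"
  using runs_append[of "[c]"] by simp

lemma runs_Inc: "runs [Inc r] s (s(r := Suc (s r)))"
  unfolding runs_def by (auto intro: dstep.intros)

lemma runs_Dec: "runs [Dec r] s (s(r := s r - 1))"
  unfolding runs_def append_Cons append_Nil by (intro allI r_into_rtranclp dstep.intros)

lemma runs_Wh_0: "s r = 0 \<Longrightarrow> runs [Wh r p] s s"
  unfolding runs_def by (auto intro: dstep.intros)

lemma runs_Wh_step:
  assumes "s r \<noteq> 0" "runs p s s'" "runs [Wh r p] s' s''"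
  shows "runs [Wh r p] s s''"
  unfolding runs_def
proof
  fix k
  have "dstep ([Wh r p] @ k, s) (p @ Wh r p # k, s)" using assms(1) by (auto intro: dstep.intros)
  also have "dstep\<^sup>*\<^sup>* (p @ Wh r p # k, s) (Wh r p # k, s')" using assms(2) unfolding runs_def by blast
  also have "dstep\<^sup>*\<^sup>* (Wh r p # k, s') (k, s'')" using assms(3) unfolding runs_def by auto
  finally show "dstep\<^sup>*\<^sup>* ([Wh r p] @ k, s) (k, s'')" by simp
qed

section \<open>Programs for clearing, moving and copying registers\<close>

definition clear :: "nat \<Rightarrow> com list" where
  "clear r = [Wh r [Dec r]]"

text \<open>The source is emptied while it is read, so \<open>t\<close> collects a second copy from
  which it is restored.\<close>

definition copy :: "nat \<Rightarrow> nat \<Rightarrow> nat \<Rightarrow> com list" where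
  "copy a r t = clear r @ clear t @ [Wh a [Dec a, Inc r, Inc t]] @ [Wh t [Dec t, Inc a]]"

lemma runs_clear: "runs (clear r) s (s(r := 0))"
  unfolding clear_def
proof (induction "s r" arbitrary: s)
  case 0
  then show ?case using runs_Wh_0[of s r] by (simp add: fun_upd_idem)
next
  case (Suc n)
  from Suc(1)[of "s(r := s r - 1)"] Suc(2) have "runs [Wh r [Dec r]] (s(r := s r - 1)) (s(r := 0))"
    by simp
  from runs_Wh_step[OF _ runs_Dec this] Suc(2) show ?case by simp
qed

lemma runs_move:
  assumes "a \<noteq> r"
  shows "runs [Wh a [Dec a, Inc r]] s (s(r := s r + s a, a := 0))"
proof (induction "s a" arbitrary: s)
  case 0
  then show ?case using runs_Wh_0[of s a] by (simp add: fun_upd_idem)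
next
  case (Suc n)
  let ?s = "s(a := s a - 1, r := Suc (s r))"
  have "runs [Dec a, Inc r] s ?s"
    using runs_Cons[OF runs_Dec[of a s] runs_Inc[of r]] assms by simp
  moreover have "runs [Wh a [Dec a, Inc r]] ?s (?s(r := ?s r + ?s a, a := 0))"
    by (rule Suc(1)) (use assms Suc(2) in auto)
  moreover have "?s(r := ?s r + ?s a, a := 0) = s(r := s r + s a, a := 0)"
    using assms Suc(2) by (auto simp: fun_eq_iff)
  ultimately show ?case using Suc(2) by (metis runs_Wh_step nat.distinct(1))
qed

lemma runs_move2:
  assumes "a \<noteq> r" "a \<noteq> t" "r \<noteq> t"
  shows "runs [Wh a [Dec a, Inc r, Inc t]] s (s(r := s r + s a, t := s t + s a, a := 0))"
proof (induction "s a" arbitrary: s)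
  case 0
  then show ?case using runs_Wh_0[of s a] by (simp add: fun_upd_idem)
next
  case (Suc n)
  let ?s = "s(a := s a - 1, r := Suc (s r), t := Suc (s t))"
  have "runs [Dec a, Inc r, Inc t] s ?s"
    using runs_Cons[OF runs_Dec[of a s] runs_Cons[OF runs_Inc[of r] runs_Inc[of t]]] assms by simp
  moreover have "runs [Wh a [Dec a, Inc r, Inc t]] ?s (?s(r := ?s r + ?s a, t := ?s t + ?s a, a := 0))"
    by (rule Suc(1)) (use assms Suc(2) in auto)
  moreover have "?s(r := ?s r + ?s a, t := ?s t + ?s a, a := 0)
      = s(r := s r + s a, t := s t + s a, a := 0)"
    using assms Suc(2) by (auto simp: fun_eq_iff)
  ultimately show ?case using Suc(2) by (metis runs_Wh_step nat.distinct(1))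
qed

lemma runs_copy:
  assumes "a \<noteq> r" "a \<noteq> t" "r \<noteq> t"
  shows "runs (copy a r t) s (s(r := s a, t := 0))"
proof -
  let ?s0 = "s(r := 0, t := 0)"
  let ?s1 = "s(r := s a, t := s a, a := 0)"
  have "runs (clear r @ clear t) s ?s0"
    using runs_append[OF runs_clear runs_clear] by blast
  moreover have "runs [Wh a [Dec a, Inc r, Inc t]] ?s0 ?s1"
    using runs_move2[OF assms, of ?s0] assms by (simp add: fun_upd_twist)
  moreover have "runs [Wh t [Dec t, Inc a]] ?s1 (s(r := s a, t := 0))"
  proof -
    have "?s1(a := ?s1 a + ?s1 t, t := 0) = s(r := s a, t := 0)"
      using assms by (auto simp: fun_eq_iff)
    then show ?thesis using runs_move[of t a ?s1] assms by simp
  qed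
  ultimately show ?thesis unfolding copy_def
    by (metis runs_append append_assoc)
qed

section \<open>Compilation of recursive functions\<close>

text \<open>\<open>compile e as r b\<close> takes its arguments from the registers \<open>as\<close>, leaves its result in \<open>r\<close>, and uses
  registers from \<open>b\<close> on as scratch space without assuming them to be clear.\<close>

fun compile :: "recf \<Rightarrow> nat list \<Rightarrow> nat \<Rightarrow> nat \<Rightarrow> com list"
  and compiles :: "recf list \<Rightarrow> nat list \<Rightarrow> nat \<Rightarrow> nat \<Rightarrow> com list" where
  "compile Zero as r b = clear r"
| "compile Succ as r b = copy (hd as) r b @ [Inc r]"
| "compile (Proj i) as r b = copy (as ! i) r b"
| "compile (Comp f gs) as r b = compiles gs as b (b + length gs)
     @ compile f [b..<b + length gs] r (b + length gs)"
| "compile (PrimRec f g) as r b = clear b @ copy (hd as) (b + 2) (b + 3)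
     @ compile f (tl as) (b + 1) (b + 4)
     @ [Wh (b + 2) ([Dec (b + 2)] @ compile g ((b + 1) # b # tl as) (b + 3) (b + 4)
         @ copy (b + 3) (b + 1) (b + 4) @ [Inc b])]
     @ copy (b + 1) r (b + 4)"
| "compile (Mu f) as r b = clear b @ compile f (b # as) (b + 1) (b + 2)
     @ [Wh (b + 1) ([Inc b] @ compile f (b # as) (b + 1) (b + 2))]
     @ copy b r (b + 2)"
| "compiles [] as r b = []"
| "compiles (g # gs) as r b = compile g as r b @ compiles gs as (Suc r) b"

text \<open>Only convergent evaluations are constrained. The frame condition on registers below
  \<open>b\<close> lets subprograms be nested; \<open>r\<close> must differ from the arguments
  because \<open>copy\<close> clears its target before it reads.\<close>

definition correct :: "recf \<Rightarrow> bool" where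
  "correct e \<longleftrightarrow> (\<forall>as r b s z. eval_recf e (map s as) z \<longrightarrow> (\<forall>a\<in>set as. a < b) \<longrightarrow> r < b \<longrightarrow>
     r \<notin> set as \<longrightarrow>
     (\<exists>s'. runs (compile e as r b) s s' \<and> s' r = z \<and> (\<forall>q<b. q \<noteq> r \<longrightarrow> s' q = s q)))"

lemma correctD:
  assumes "correct e" "eval_recf e (map s as) z" "\<And>a. a \<in> set as \<Longrightarrow> a < b" "r < b" "r \<notin> set as"
  obtains s' where "runs (compile e as r b) s s'" "s' r = z" "\<And>q. q < b \<Longrightarrow> q \<noteq> r \<Longrightarrow> s' q = s q"
  using assms(1)[unfolded correct_def, rule_format, OF assms(2) _ assms(4,5)] assms(3) that by auto

lemma compiles_correct:
  assumes "\<And>g. g \<in> set gs \<Longrightarrow> correct g" "length ys = length gs"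
    "\<And>i. i < length gs \<Longrightarrow> eval_recf (gs ! i) (map s as) (ys ! i)"
    "\<And>a. a \<in> set as \<Longrightarrow> a < r" "r + length gs \<le> b"
  shows "\<exists>s'. runs (compiles gs as r b) s s' \<and> (\<forall>i<length gs. s' (r + i) = ys ! i) \<and> (\<forall>q<r. s' q = s q)"
  using assms
proof (induction gs arbitrary: ys s r)
  case Nil
  then show ?case by (auto intro: runs_Nil)
next
  case (Cons g gs)
  obtain y ys' where ys: "ys = y # ys'" using Cons.prems(2) by (cases ys) auto
  have evg: "eval_recf g (map s as) y" using Cons.prems(3)[of 0] ys by simp
  have "correct g" using Cons.prems(1) by simp
  then obtain s1 where s1: "runs (compile g as r b) s s1" "s1 r = y"
    "\<And>q. q < b \<Longrightarrow> q \<noteq> r \<Longrightarrow> s1 q = s q"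
    by (rule correctD[OF _ evg, where b = b and r = r]) (use Cons.prems(4,5) in force)+
  have as: "map s1 as = map s as" using s1(3) Cons.prems(4,5) by fastforce
  have "\<exists>s'. runs (compiles gs as (Suc r) b) s1 s' \<and> (\<forall>i<length gs. s' (Suc r + i) = ys' ! i)
      \<and> (\<forall>q<Suc r. s' q = s1 q)"
  proof (rule Cons.IH)
    show "eval_recf (gs ! i) (map s1 as) (ys' ! i)" if "i < length gs" for i
      using Cons.prems(3)[of "Suc i"] that unfolding ys as by simp
  qed (use Cons.prems ys in \<open>auto intro: less_SucI\<close>)
  then obtain s' where s': "runs (compiles gs as (Suc r) b) s1 s'"
    "\<And>i. i < length gs \<Longrightarrow> s' (Suc r + i) = ys' ! i" "\<And>q. q < Suc r \<Longrightarrow> s' q = s1 q" by blast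
  have "s' (r + i) = ys ! i" if "i < length (g # gs)" for i
    using that s'(2)[of "i - 1"] s'(3)[of r] s1(2) ys by (cases i) auto
  moreover have "s' q = s q" if "q < r" for q
    using that s'(3) s1(3)[of q] Cons.prems(5) by simp
  ultimately show ?case using runs_append[OF s1(1) s'(1)] by auto
qed

inductive_cases eval_Zero: "eval_recf Zero xs z"
inductive_cases eval_Succ: "eval_recf Succ xs z"
inductive_cases eval_Proj: "eval_recf (Proj i) xs z"
inductive_cases eval_Comp: "eval_recf (Comp f gs) xs z"
inductive_cases eval_PrimRec: "eval_recf (PrimRec f g) xs z"
inductive_cases eval_PrimRec_0: "eval_recf (PrimRec f g) (0 # xs) z"
inductive_cases eval_PrimRec_Suc: "eval_recf (PrimRec f g) (Suc n # xs) z"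
inductive_cases eval_Mu: "eval_recf (Mu f) xs z"

text \<open>Unfolds the derivation into the values after each round, the form in which a loop
  invariant can refer to them.\<close>

lemma eval_PrimRec_seq:
  "eval_recf (PrimRec f g) (n # xs) y \<Longrightarrow>
    \<exists>Z. eval_recf f xs (Z 0) \<and> (\<forall>i<n. eval_recf g (Z i # i # xs) (Z (Suc i))) \<and> Z n = y"
proof (induction n arbitrary: y)
  case 0
  then show ?case by (auto elim!: eval_PrimRec_0)
next
  case (Suc n)
  then obtain z where z: "eval_recf (PrimRec f g) (n # xs) z" "eval_recf g (z # n # xs) y"
    by (auto elim: eval_PrimRec_Suc)
  from Suc.IH[OF z(1)] obtain Z where "eval_recf f xs (Z 0)"
    "\<forall>i<n. eval_recf g (Z i # i # xs) (Z (Suc i))" "Z n = z" by blast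
  then show ?case using z(2)
    by (intro exI[of _ "Z(Suc n := y)"]) (auto simp: less_Suc_eq)
qed

lemma correct_PrimRec:
  assumes f: "correct f" and g: "correct g"
  shows "correct (PrimRec f g)"
  unfolding correct_def
proof (intro allI impI)
  fix as :: "nat list" and r b :: nat and s z
  assume ev: "eval_recf (PrimRec f g) (map s as) z" and as: "\<forall>a\<in>set as. a < b"
    and r: "r < b" "r \<notin> set as"
  obtain a as' where as': "as = a # as'" using ev by (cases as) (auto elim: eval_PrimRec)
  define xs where "xs = map s as'"
  obtain Z where Z: "eval_recf f xs (Z 0)" "\<And>i. i < s a \<Longrightarrow> eval_recf g (Z i # i # xs) (Z (Suc i))"
    "Z (s a) = z"
    using eval_PrimRec_seq[of f g "s a" xs z] ev unfolding as' xs_def by auto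
  let ?n = "s a"
  let ?body = "[Dec (b + 2)] @ compile g ((b + 1) # b # as') (b + 3) (b + 4)
         @ copy (b + 3) (b + 1) (b + 4) @ [Inc b]"
  \<comment> \<open>Here \<open>j\<close> rounds are left. Register \<open>b\<close> counts the
    completed rounds, \<open>b + 1\<close> holds the value so far, \<open>b + 2\<close> the
    remaining rounds, and \<open>b + 3\<close> receives the next value.\<close>
  have loop: "\<exists>s'. runs [Wh (b + 2) ?body] t s' \<and> s' (b + 1) = z \<and> (\<forall>q<b. s' q = t q)"
    if "t (b + 2) = j" "j \<le> ?n" "t b = ?n - j" "t (b + 1) = Z (?n - j)" "map t as' = xs" for t j
    using that
  proof (induction j arbitrary: t)
    case 0
    then show ?case using runs_Wh_0[of t "b + 2"] Z(3) by auto
  next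
    case (Suc j)
    let ?i = "?n - Suc j"
    let ?t1 = "t(b + 2 := j)"
    have 1: "runs [Dec (b + 2)] t ?t1" using runs_Dec[of "b + 2" t] Suc.prems(1) by simp
    have "b + 2 \<notin> set as'" using as as' by auto
    then have "map ?t1 as' = xs" using Suc.prems(5) by simp
    then have ev1: "eval_recf g (map ?t1 ((b + 1) # b # as')) (Z (Suc ?i))"
      using Z(2)[of ?i] Suc.prems by simp
    obtain t2 where t2: "runs (compile g ((b + 1) # b # as') (b + 3) (b + 4)) ?t1 t2"
      "t2 (b + 3) = Z (Suc ?i)" "\<And>q. q < b + 4 \<Longrightarrow> q \<noteq> b + 3 \<Longrightarrow> t2 q = ?t1 q"
      by (rule correctD[OF g ev1, of "b + 4" "b + 3"]) (use as as' in auto)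
    let ?t3 = "t2(b + 1 := t2 (b + 3), b + 4 := 0)"
    have 3: "runs (copy (b + 3) (b + 1) (b + 4)) t2 ?t3" by (rule runs_copy) auto
    let ?t4 = "?t3(b := Suc (?t3 b))"
    have body: "runs ?body t ?t4"
      by (intro runs_append[OF 1] runs_append[OF t2(1)] runs_append[OF 3] runs_Inc)
    have "\<exists>s'. runs [Wh (b + 2) ?body] ?t4 s' \<and> s' (b + 1) = z \<and> (\<forall>q<b. s' q = ?t4 q)"
    proof (rule Suc.IH)
      show "?t4 (b + 2) = j" using t2(3)[of "b + 2"] by simp
      show "?t4 b = ?n - j" using t2(3)[of b] Suc.prems by simp
      show "?t4 (b + 1) = Z (?n - j)" using t2(2) Suc.prems by (simp add: Suc_diff_Suc)
      show "map ?t4 as' = xs" using t2(3) as as' Suc.prems(5) by fastforce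
    qed (use Suc.prems in auto)
    then obtain s' where s': "runs [Wh (b + 2) ?body] ?t4 s'" "s' (b + 1) = z"
      "\<And>q. q < b \<Longrightarrow> s' q = ?t4 q" by blast
    have "runs [Wh (b + 2) ?body] t s'"
      using runs_Wh_step[OF _ body s'(1)] Suc.prems(1) by simp
    moreover have "s' q = t q" if "q < b" for q using s'(3)[OF that] t2(3)[of q] that by simp
    ultimately show ?case using s'(2) by blast
  qed
  let ?s1 = "s(b := 0, b + 2 := s a, b + 3 := 0)"
  have "a < b" using as as' by simp
  have 1: "runs (clear b) s (s(b := 0))" by (rule runs_clear)
  have 2: "runs (copy a (b + 2) (b + 3)) (s(b := 0)) ?s1"
    using runs_copy[of a "b + 2" "b + 3" "s(b := 0)"] \<open>a < b\<close> by simp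
  have "map ?s1 as' = xs" using as as' unfolding xs_def by auto
  then have "eval_recf f (map ?s1 as') (Z 0)" using Z(1) by simp
  then obtain s2 where s2: "runs (compile f as' (b + 1) (b + 4)) ?s1 s2" "s2 (b + 1) = Z 0"
    "\<And>q. q < b + 4 \<Longrightarrow> q \<noteq> b + 1 \<Longrightarrow> s2 q = ?s1 q"
    by (rule correctD[OF f, where b = "b + 4" and r = "b + 1"]) (use as as' in auto)
  have "map s2 as' = xs" using s2(3) as as' unfolding xs_def by fastforce
  then have "\<exists>s'. runs [Wh (b + 2) ?body] s2 s' \<and> s' (b + 1) = z \<and> (\<forall>q<b. s' q = s2 q)"
    using s2(2) s2(3)[of b] s2(3)[of "b + 2"] by (intro loop[of s2 ?n]) auto
  then obtain s3 where s3: "runs [Wh (b + 2) ?body] s2 s3" "s3 (b + 1) = z" "\<And>q. q < b \<Longrightarrow> s3 q = s2 q"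
    by blast
  have 4: "runs (copy (b + 1) r (b + 4)) s3 (s3(r := s3 (b + 1), b + 4 := 0))"
    by (rule runs_copy) (use r in auto)
  have "runs (compile (PrimRec f g) as r b) s (s3(r := s3 (b + 1), b + 4 := 0))"
    unfolding as' compile.simps list.sel
    by (intro runs_append[OF 1] runs_append[OF 2] runs_append[OF s2(1)] runs_append[OF s3(1)] 4)
  then show "\<exists>s'. runs (compile (PrimRec f g) as r b) s s' \<and> s' r = z \<and> (\<forall>q<b. q \<noteq> r \<longrightarrow> s' q = s q)"
    using r s3 s2(3) by (intro exI[of _ "s3(r := s3 (b + 1), b + 4 := 0)"]) auto
qed

lemma correct_Mu:
  assumes f: "correct f"
  shows "correct (Mu f)"
  unfolding correct_def
proof (intro allI impI)
  fix as :: "nat list" and r b :: nat and s n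
  assume ev: "eval_recf (Mu f) (map s as) n" and as: "\<forall>a\<in>set as. a < b"
    and r: "r < b" "r \<notin> set as"
  define xs where "xs = map s as"
  from ev have ev0: "eval_recf f (n # xs) 0" and evm: "\<And>m. m < n \<Longrightarrow> \<exists>z. eval_recf f (m # xs) z \<and> z \<noteq> 0"
    unfolding xs_def by (auto elim: eval_Mu)
  let ?c = "compile f (b # as) (b + 1) (b + 2)"
  \<comment> \<open>Register \<open>b\<close> holds the candidate and \<open>b + 1\<close> the value
    of \<open>f\<close> there, so the loop stops exactly at the least zero; the premises of the
    \<open>mu\<close> rule make all earlier evaluations converge.\<close>
  have test: "\<exists>t'. runs ?c t t' \<and> (t' (b + 1) = 0 \<longleftrightarrow> t b = n) \<and> (\<forall>q\<le>b. t' q = t q)"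
    if tb: "t b \<le> n" "map t as = xs" for t
  proof -
    have "\<exists>z. eval_recf f (t b # xs) z \<and> (z = 0 \<longleftrightarrow> t b = n)"
      using tb(1) ev0 evm[of "t b"] by (cases "t b = n") auto
    then obtain z where z: "eval_recf f (map t (b # as)) z" "z = 0 \<longleftrightarrow> t b = n"
      unfolding tb(2)[symmetric] by auto
    show ?thesis
      by (rule correctD[OF f z(1), of "b + 2" "b + 1"]) (use as z(2) in force)+
  qed
  have loop: "\<exists>s'. runs [Wh (b + 1) ([Inc b] @ ?c)] t s' \<and> s' b = n \<and> (\<forall>q<b. s' q = t q)"
    if "t b + j = n" "t (b + 1) = 0 \<longleftrightarrow> t b = n" "map t as = xs" for t j
    using that
  proof (induction j arbitrary: t)
    case 0
    then show ?case using runs_Wh_0[of t "b + 1"] by auto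
  next
    case (Suc j)
    let ?t1 = "t(b := Suc (t b))"
    have m1: "map ?t1 as = xs" using Suc.prems(3) as by auto
    have "?t1 b \<le> n" using Suc.prems(1) by simp
    from test[OF this m1] obtain t2 where
      "runs ?c ?t1 t2 \<and> (t2 (b + 1) = 0 \<longleftrightarrow> ?t1 b = n) \<and> (\<forall>q\<le>b. t2 q = ?t1 q)" ..
    then have t2: "runs ?c ?t1 t2" "t2 (b + 1) = 0 \<longleftrightarrow> ?t1 b = n" "\<And>q. q \<le> b \<Longrightarrow> t2 q = ?t1 q"
      by simp_all
    have "map t2 as = xs" using t2(3) as m1 by fastforce
    then have "\<exists>s'. runs [Wh (b + 1) ([Inc b] @ ?c)] t2 s' \<and> s' b = n \<and> (\<forall>q<b. s' q = t2 q)"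
      using t2(2) t2(3)[of b] Suc.prems(1) by (intro Suc.IH) auto
    then obtain s' where s': "runs [Wh (b + 1) ([Inc b] @ ?c)] t2 s'" "s' b = n" "\<And>q. q < b \<Longrightarrow> s' q = t2 q"
      by blast
    have "runs [Wh (b + 1) ([Inc b] @ ?c)] t s'"
      using runs_Wh_step[OF _ runs_append[OF runs_Inc t2(1)] s'(1)] Suc.prems(1,2) by auto
    moreover have "s' q = t q" if "q < b" for q using that s'(3) t2(3)[of q] by simp
    ultimately show ?case using s'(2) by blast
  qed
  let ?s1 = "s(b := 0)"
  have m1: "map ?s1 as = xs" using as unfolding xs_def by auto
  obtain s2 where s2: "runs ?c ?s1 s2" "s2 (b + 1) = 0 \<longleftrightarrow> ?s1 b = n" "\<And>q. q \<le> b \<Longrightarrow> s2 q = ?s1 q"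
    using test[OF _ m1] by auto
  have "map s2 as = xs" using s2(3) as m1 by fastforce
  then have "\<exists>s'. runs [Wh (b + 1) ([Inc b] @ ?c)] s2 s' \<and> s' b = n \<and> (\<forall>q<b. s' q = s2 q)"
    using s2(2) s2(3)[of b] by (intro loop[of s2 n]) auto
  then obtain s3 where s3: "runs [Wh (b + 1) ([Inc b] @ ?c)] s2 s3" "s3 b = n" "\<And>q. q < b \<Longrightarrow> s3 q = s2 q"
    by blast
  have 4: "runs (copy b r (b + 2)) s3 (s3(r := s3 b, b + 2 := 0))"
    by (rule runs_copy) (use r in auto)
  have "runs (compile (Mu f) as r b) s (s3(r := s3 b, b + 2 := 0))"
    unfolding compile.simps
    by (intro runs_append[OF runs_clear] runs_append[OF s2(1)] runs_append[OF s3(1)] 4)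
  then show "\<exists>s'. runs (compile (Mu f) as r b) s s' \<and> s' r = n \<and> (\<forall>q<b. q \<noteq> r \<longrightarrow> s' q = s q)"
    using r s3 s2(3) by (intro exI[of _ "s3(r := s3 b, b + 2 := 0)"]) auto
qed

lemma correct_Comp:
  assumes f: "correct f" and gs: "\<And>g. g \<in> set gs \<Longrightarrow> correct g"
  shows "correct (Comp f gs)"
  unfolding correct_def
proof (intro allI impI)
  fix as :: "nat list" and r b :: nat and s z
  assume ev: "eval_recf (Comp f gs) (map s as) z" and as: "\<forall>a\<in>set as. a < b"
    and r: "r < b" "r \<notin> set as"
  obtain ys where ys: "length ys = length gs" "\<And>i. i < length gs \<Longrightarrow> eval_recf (gs ! i) (map s as) (ys ! i)"
    "eval_recf f ys z"
    using ev by (auto elim: eval_Comp)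
  obtain s1 where s1: "runs (compiles gs as b (b + length gs)) s s1"
    "\<And>i. i < length gs \<Longrightarrow> s1 (b + i) = ys ! i" "\<And>q. q < b \<Longrightarrow> s1 q = s q"
    using compiles_correct[of gs ys s as b "b + length gs"] gs ys(1,2) as by auto
  have "map s1 [b..<b + length gs] = ys"
    using s1(2) ys(1) by (auto intro: nth_equalityI)
  then have ev1: "eval_recf f (map s1 [b..<b + length gs]) z" using ys(3) by simp
  obtain s2 where s2: "runs (compile f [b..<b + length gs] r (b + length gs)) s1 s2" "s2 r = z"
    "\<And>q. q < b + length gs \<Longrightarrow> q \<noteq> r \<Longrightarrow> s2 q = s1 q"
    by (rule correctD[OF f ev1, of "b + length gs" r]) (use r in auto)
  have "runs (compile (Comp f gs) as r b) s s2"
    using runs_append[OF s1(1) s2(1)] by simp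
  then show "\<exists>s'. runs (compile (Comp f gs) as r b) s s' \<and> s' r = z \<and> (\<forall>q<b. q \<noteq> r \<longrightarrow> s' q = s q)"
    using s1(3) s2(2,3) by auto
qed

lemma compile_correct: "correct e"
proof (induction e)
  case Zero
  show ?case unfolding correct_def using runs_clear by (fastforce elim: eval_Zero)
next
  case Succ
  show ?case unfolding correct_def
  proof (intro allI impI)
    fix as :: "nat list" and r b :: nat and s z
    assume *: "eval_recf Succ (map s as) z" "\<forall>a\<in>set as. a < b" "r < b" "r \<notin> set as"
    then obtain a as' where as: "as = a # as'" "z = Suc (s a)"
      by (auto elim!: eval_Succ)
    then have "runs (compile Succ as r b) s (s(r := s a, b := 0, r := Suc (s a)))"
      using runs_append[OF runs_copy[of a r b s] runs_Inc[of r]] * by auto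
    then show "\<exists>s'. runs (compile Succ as r b) s s' \<and> s' r = z \<and> (\<forall>q<b. q \<noteq> r \<longrightarrow> s' q = s q)"
      using as by (intro exI[of _ "s(r := s a, b := 0, r := Suc (s a))"]) auto
  qed
next
  case (Proj i)
  show ?case unfolding correct_def
  proof (intro allI impI)
    fix as :: "nat list" and r b :: nat and s z
    assume *: "eval_recf (Proj i) (map s as) z" "\<forall>a\<in>set as. a < b" "r < b" "r \<notin> set as"
    then have i: "i < length as" "z = s (as ! i)" by (auto elim!: eval_Proj)
    then have "as ! i \<in> set as" by simp
    then have "runs (compile (Proj i) as r b) s (s(r := s (as ! i), b := 0))"
      using * by (auto intro!: runs_copy)
    then show "\<exists>s'. runs (compile (Proj i) as r b) s s' \<and> s' r = z \<and> (\<forall>q<b. q \<noteq> r \<longrightarrow> s' q = s q)"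
      using i * by (intro exI[of _ "s(r := s (as ! i), b := 0)"]) auto
  qed
qed (auto intro: correct_Comp correct_PrimRec correct_Mu)

section \<open>The machine with guessing and its fair runs\<close>

type_synonym pc = "com list option"

text \<open>The control point \<open>None\<close> occurs only at time 0. \<open>Z\<close> is the set of nonzero registers.\<close>

fun nxt :: "com list \<Rightarrow> pc \<Rightarrow> nat set \<Rightarrow> pc set" where
  "nxt p0 None Z = {Some p0}"
| "nxt p0 (Some []) Z = {}"
| "nxt p0 (Some (Inc r # k)) Z = {Some k}"
| "nxt p0 (Some (Dec r # k)) Z = {Some k}"
| "nxt p0 (Some (Wh r p # k)) Z = {Some (if r \<in> Z then p @ Wh r p # k else k)}"
| "nxt p0 (Some (Guess r # k)) Z = {Some (Guess r # k), Some k}"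

fun act :: "pc \<Rightarrow> (nat \<Rightarrow> nat) \<Rightarrow> (nat \<Rightarrow> nat)" where
  "act (Some (Inc r # k)) s = s(r := Suc (s r))"
| "act (Some (Guess r # k)) s = s(r := Suc (s r))"
| "act (Some (Dec r # k)) s = s(r := s r - 1)"
| "act _ s = s"

definition is_guess :: "pc \<Rightarrow> bool" where
  "is_guess p \<longleftrightarrow> (\<exists>r k. p = Some (Guess r # k))"

definition mstep :: "com list \<Rightarrow> pc \<times> (nat \<Rightarrow> nat) \<Rightarrow> pc \<times> (nat \<Rightarrow> nat) \<Rightarrow> bool" where
  "mstep p0 C C' \<longleftrightarrow> fst C' \<in> nxt p0 (fst C) {r. snd C r \<noteq> 0} \<and> snd C' = act (fst C) (snd C)"

definition input :: "nat \<Rightarrow> nat \<Rightarrow> nat" where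
  "input n = (\<lambda>_. 0)(0 := n)"

text \<open>No control point follows the empty continuation, so asking for an infinite run already
  excludes that the program ends.\<close>

definition fair_run :: "com list \<Rightarrow> nat \<Rightarrow> (nat \<Rightarrow> pc) \<Rightarrow> (nat \<Rightarrow> nat \<Rightarrow> nat) \<Rightarrow> bool" where
  "fair_run p0 n P S \<longleftrightarrow> P 0 = None \<and> S 0 = input n \<and>
     (\<forall>t. mstep p0 (P t, S t) (P (Suc t), S (Suc t))) \<and> (\<forall>t. \<exists>t'\<ge>t. \<not> is_guess (P t'))"

text \<open>An equivalence, because both directions are used: a run can be built along deterministic
  steps, and a given run has to follow them.\<close>

lemma dstep_imp_mstep:
  assumes "dstep (p, s) (q, s')"
  shows "mstep p0 (Some p, s) C \<longleftrightarrow> C = (Some q, s')"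
  using assms by (cases rule: dstep.cases) (cases C; auto simp: mstep_def)+

lemma dsteps_imp_msteps:
  assumes "dstep\<^sup>*\<^sup>* (p, s) (q, s')"
  shows "(mstep p0)\<^sup>*\<^sup>* (Some p, s) (Some q, s')"
  using assms
proof (induction "(q, s')" arbitrary: q s' rule: rtranclp_induct)
  case (step C)
  then show ?case using dstep_imp_mstep by (cases C) (metis rtranclp.rtrancl_into_rtrancl)
qed simp

text \<open>\<open>T n c c' = 0\<close> means that \<open>c'\<close> may follow \<open>c\<close>.
  The number 0 must never be a successor, since \<open>Guess\<close> increments its register at
  least once and cannot produce it.\<close>

locale guess_loop =
  fixes T :: "nat \<Rightarrow> nat \<Rightarrow> nat \<Rightarrow> nat" and e :: recf
  assumes e: "\<And>n c c'. eval_recf e [n, c, c'] (T n c c')"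
    and T0: "\<And>n c. T n c 0 \<noteq> 0"
begin

text \<open>Register 0 holds the input, 1 the current element of the chain, 2 the guess, 3 the flag of the main
  loop, which a failed check clears so that the program ends, and 4 the outcome of the check.\<close>

definition test :: "com list" where
  "test = compile e [0, 1, 2] 4 5 @ [Wh 4 (clear 3 @ clear 4)] @ clear 1 @ [Wh 2 [Dec 2, Inc 1]]"

definition loop :: "com list" where
  "loop = [Wh 3 (Guess 2 # test)]"

definition prog :: "com list" where
  "prog = Inc 3 # loop"

text \<open>Registers from 4 on stay free, since compiled code does not rely on clean scratch
  space.\<close>

definition at_head :: "nat \<Rightarrow> nat \<Rightarrow> pc \<times> (nat \<Rightarrow> nat) \<Rightarrow> bool" where
  "at_head n c C \<longleftrightarrow> fst C = Some loop \<and> snd C 0 = n \<and> snd C 1 = c \<and> snd C 2 = 0 \<and> snd C 3 = 1"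

lemma runs_test:
  assumes "s 0 = n" "s 1 = c" "s 2 = c'" "s 3 = 1"
  shows "\<exists>s'. runs test s s' \<and> (T n c c' \<noteq> 0 \<longrightarrow> s' 3 = 0) \<and>
    (T n c c' = 0 \<longrightarrow> s' 0 = n \<and> s' 1 = c' \<and> s' 2 = 0 \<and> s' 3 = 1)"
proof -
  have "eval_recf e (map s [0, 1, 2]) (T n c c')" using e assms by auto
  then obtain s1 where s1: "runs (compile e [0, 1, 2] 4 5) s s1" "s1 4 = T n c c'"
    "\<And>q. q < 5 \<Longrightarrow> q \<noteq> 4 \<Longrightarrow> s1 q = s q"
    by (rule correctD[OF compile_correct, where b = 5 and r = 4]) auto
  have "\<exists>s2. runs [Wh 4 (clear 3 @ clear 4)] s1 s2 \<and> s2 3 = (if T n c c' = 0 then 1 else 0)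
      \<and> (\<forall>q<3. s2 q = s q)"
  proof (cases "T n c c' = 0")
    case True
    then show ?thesis using runs_Wh_0[of s1 4] s1 assms by (intro exI[of _ s1]) auto
  next
    case False
    let ?s2 = "s1(3 := 0, 4 := 0)"
    have "runs (clear 3 @ clear 4) s1 ?s2" by (rule runs_append[OF runs_clear runs_clear])
    moreover have "runs [Wh 4 (clear 3 @ clear 4)] ?s2 ?s2" by (rule runs_Wh_0) simp
    ultimately have "runs [Wh 4 (clear 3 @ clear 4)] s1 ?s2"
      by (rule runs_Wh_step[rotated]) (use False s1(2) in simp)
    then show ?thesis using s1(3) False by (intro exI[of _ ?s2]) auto
  qed
  then obtain s2 where s2: "runs [Wh 4 (clear 3 @ clear 4)] s1 s2"
    "s2 3 = (if T n c c' = 0 then 1 else 0)" "\<And>q. q < 3 \<Longrightarrow> s2 q = s q" by blast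
  let ?s3 = "s2(1 := 0)"
  let ?s4 = "?s3(1 := ?s3 1 + ?s3 2, 2 := 0)"
  have "runs [Wh 2 [Dec 2, Inc 1]] ?s3 ?s4" by (rule runs_move) simp
  then have "runs test s ?s4" unfolding test_def
    by (intro runs_append[OF s1(1)] runs_append[OF s2(1)] runs_append[OF runs_clear])
  then show ?thesis using s2(2,3) assms by (intro exI[of _ ?s4]) auto
qed

lemma dsteps_test:
  assumes "s 0 = n" "s 1 = c" "s 2 = c'" "s 3 = 1"
  obtains s' where "dstep\<^sup>*\<^sup>* (test @ loop, s) (loop, s')" "T n c c' \<noteq> 0 \<Longrightarrow> s' 3 = 0"
    "T n c c' = 0 \<Longrightarrow> at_head n c' (Some loop, s')"
proof -
  from runs_test[OF assms] obtain s' where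
    "runs test s s' \<and> (T n c c' \<noteq> 0 \<longrightarrow> s' 3 = 0) \<and>
      (T n c c' = 0 \<longrightarrow> s' 0 = n \<and> s' 1 = c' \<and> s' 2 = 0 \<and> s' 3 = 1)" ..
  note s' = conjunct1[OF this] conjunct2[OF this]
  from s'(1) have "dstep\<^sup>*\<^sup>* (test @ loop, s) (loop, s')" unfolding runs_def by (rule spec)
  then show ?thesis by (rule that) (use s'(2) in \<open>simp_all add: at_head_def\<close>)
qed

lemma dstep_loop: "s 3 \<noteq> 0 \<Longrightarrow> dstep (loop, s) (Guess 2 # test @ loop, s)"
  unfolding loop_def using dstep.intros(4)[of s 3 "Guess 2 # test" "[]"] by simp

lemma dstep_loop_exit: "s 3 = 0 \<Longrightarrow> dstep (loop, s) ([], s)"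
  unfolding loop_def by (rule dstep.intros(3))

lemma msteps_guess: "(mstep p0)\<^sup>*\<^sup>* (Some (Guess r # k), s) (Some k, s(r := s r + Suc j))"
proof (induction j arbitrary: s)
  case 0
  show ?case by (rule r_into_rtranclp) (simp add: mstep_def fun_eq_iff)
next
  case (Suc j)
  have "mstep p0 (Some (Guess r # k), s) (Some (Guess r # k), s(r := Suc (s r)))"
    by (simp add: mstep_def)
  also have "(mstep p0)\<^sup>*\<^sup>* (Some (Guess r # k), s(r := Suc (s r))) (Some k, s(r := s r + Suc (Suc j)))"
  proof -
    have "(s(r := Suc (s r)))(r := (s(r := Suc (s r))) r + Suc j) = s(r := s r + Suc (Suc j))"
      by (simp add: fun_eq_iff)
    then show ?thesis using Suc[of "s(r := Suc (s r))"] by (simp only:)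
  qed
  finally show ?case .
qed

text \<open>The first step is split off so that segments between heads are nonempty and an infinite
  run can be assembled from them.\<close>

lemma head_to_head:
  assumes "at_head n c C" "T n c c' = 0"
  obtains C1 C' where "mstep prog C C1" "(mstep prog)\<^sup>*\<^sup>* C1 C'" "at_head n c' C'"
proof -
  obtain s where C: "C = (Some loop, s)" and s: "s 0 = n" "s 1 = c" "s 2 = 0" "s 3 = 1"
    using assms(1) unfolding at_head_def by (cases C) auto
  have "c' \<noteq> 0" using assms(2) T0[of n c] by (cases "c' = 0") auto
  then obtain j where j: "c' = Suc j" by (cases c') auto
  have 1: "mstep prog C (Some (Guess 2 # test @ loop), s)"
    using dstep_imp_mstep[OF dstep_loop] s unfolding C by simp
  have 2: "(mstep prog)\<^sup>*\<^sup>* (Some (Guess 2 # test @ loop), s) (Some (test @ loop), s(2 := c'))"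
    using msteps_guess[of prog 2 "test @ loop" s j] s j by simp
  obtain s' where s': "dstep\<^sup>*\<^sup>* (test @ loop, s(2 := c')) (loop, s')" "at_head n c' (Some loop, s')"
    using dsteps_test[of "s(2 := c')" n c c'] s assms(2) by auto
  from 2 dsteps_imp_msteps[OF s'(1)] have "(mstep prog)\<^sup>*\<^sup>* (Some (Guess 2 # test @ loop), s) (Some loop, s')"
    by (rule rtranclp_trans)
  then show ?thesis using that 1 s'(2) by blast
qed

text \<open>Finite segments are glued by dependent choice on pairs of a countdown and a machine
  configuration. The countdown reaches 0 infinitely often, and then control is at the head of the
  loop, which is not a guess; this gives fairness.\<close>

lemma fair_run_if_chain:
  assumes c: "c 0 = 0" "\<And>i. T n (c i) (c (Suc i)) = 0"
  shows "\<exists>P S. fair_run prog n P S"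
proof -
  define J where "J = (\<lambda>(d, C). \<exists>i C'. (mstep prog ^^ d) C C' \<and> at_head n (c i) C')"
  define s1 where "s1 = (input n)(3 := 1)"
  have "mstep prog (None, input n) (Some prog, input n)" by (simp add: mstep_def)
  moreover have "mstep prog (Some prog, input n) (Some loop, s1)"
    unfolding prog_def mstep_def s1_def by (simp add: input_def)
  ultimately have "(mstep prog)\<^sup>*\<^sup>* (None, input n) (Some loop, s1)"
    by (meson converse_rtranclp_into_rtranclp r_into_rtranclp)
  moreover have "at_head n (c 0) (Some loop, s1)"
    unfolding at_head_def s1_def using c(1) by (simp add: input_def)
  ultimately obtain d0 where d0: "J (d0, (None, input n))"
    unfolding J_def by (auto simp: rtranclp_power)
  have step: "\<exists>y. J y \<and> mstep prog (snd x) (snd y) \<and> (fst x \<noteq> 0 \<longrightarrow> fst y < fst x)"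
    if "J x" for x
  proof -
    obtain d C where x: "x = (d, C)" by (cases x)
    from that obtain i C' where C': "(mstep prog ^^ d) C C'" "at_head n (c i) C'"
      unfolding J_def x by auto
    show ?thesis
    proof (cases d)
      case 0
      then have "at_head n (c i) C" using C' by simp
      from head_to_head[OF this c(2)] obtain C1 C' where
        "mstep prog C C1" "(mstep prog)\<^sup>*\<^sup>* C1 C'" "at_head n (c (Suc i)) C'" by metis
      moreover from this obtain d' where "(mstep prog ^^ d') C1 C'" by (auto simp: rtranclp_power)
      ultimately have "J (d', C1)" "mstep prog C C1" unfolding J_def by (simp only: prod.case, blast, simp)
      then show ?thesis unfolding x 0 by (intro exI[of _ "(d', C1)"]) simp
    next
      case (Suc d')
      then obtain C1 where "mstep prog C C1" "(mstep prog ^^ d') C1 C'"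
        using C'(1) by (metis relpowp_Suc_E2)
      then have "J (d', C1)" "mstep prog C C1"
        using C'(2) unfolding J_def by (simp only: prod.case, blast, simp)
      then show ?thesis unfolding x Suc by (intro exI[of _ "(d', C1)"]) simp
    qed
  qed
  have "\<exists>f. \<forall>t. (J (f t) \<and> (t = 0 \<longrightarrow> f t = (d0, (None, input n)))) \<and>
     (mstep prog (snd (f t)) (snd (f (Suc t))) \<and> (fst (f t) \<noteq> 0 \<longrightarrow> fst (f (Suc t)) < fst (f t)))"
    by (rule dependent_nat_choice[of "\<lambda>t x. J x \<and> (t = 0 \<longrightarrow> x = (d0, (None, input n)))"
          "\<lambda>t x y. mstep prog (snd x) (snd y) \<and> (fst x \<noteq> 0 \<longrightarrow> fst y < fst x)"])
      (use d0 step in blast)+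
  then obtain f where f: "\<And>t. J (f t)" "f 0 = (d0, (None, input n))"
    "\<And>t. mstep prog (snd (f t)) (snd (f (Suc t)))"
    "\<And>t. fst (f t) \<noteq> 0 \<Longrightarrow> fst (f (Suc t)) < fst (f t)" by blast
  have "\<exists>t'\<ge>t. fst (f t') = 0" for t
  proof (induction "fst (f t)" arbitrary: t rule: less_induct)
    case less
    show ?case
    proof (cases "fst (f t) = 0")
      case False
      from less[OF f(4)[OF this]] show ?thesis by (meson Suc_leD)
    qed auto
  qed
  moreover have "\<not> is_guess (fst (snd (f t)))" if "fst (f t) = 0" for t
    using f(1)[of t] that unfolding J_def at_head_def is_guess_def loop_def by (auto simp: split_beta)
  ultimately have "\<exists>t'\<ge>t. \<not> is_guess (fst (snd (f t')))" for t by blast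
  then have "fair_run prog n (\<lambda>t. fst (snd (f t))) (\<lambda>t. snd (snd (f t)))"
    unfolding fair_run_def using f(2,3) by simp
  then show ?thesis by blast
qed

context
  fixes n P S
  assumes run: "fair_run prog n P S"
begin

lemma run_step: "mstep prog (P t, S t) (P (Suc t), S (Suc t))"
  using run unfolding fair_run_def by blast

lemma run_dsteps:
  assumes "dstep\<^sup>*\<^sup>* (p, s) (q, s')" "P t = Some p" "S t = s"
  shows "\<exists>t'\<ge>t. P t' = Some q \<and> S t' = s'"
  using assms
proof (induction "(q, s')" arbitrary: q s' rule: rtranclp_induct)
  case base
  then show ?case by auto
next
  case (step C)
  obtain q1 s1 where C: "C = (q1, s1)" by (cases C)
  from step.hyps(3)[OF C] step.prems obtain t' where t': "t' \<ge> t" "P t' = Some q1" "S t' = s1" by blast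
  from run_step[of t'] have "P (Suc t') = Some q \<and> S (Suc t') = s'"
    using dstep_imp_mstep[OF step.hyps(2)[unfolded C]] t' by simp
  then show ?case using t'(1) by (intro exI[of _ "Suc t'"]) auto
qed

text \<open>Fairness enters here: the distance to some time outside guessing bounds the number of
  repetitions.\<close>

lemma run_guess:
  assumes "P t = Some (Guess r # k)"
  shows "\<exists>t'\<ge>t. \<exists>j. P t' = Some k \<and> S t' = (S t)(r := S t r + Suc j)"
proof -
  have "\<exists>t'\<ge>t. \<not> is_guess (P t')" using run unfolding fair_run_def by blast
  then obtain d where "\<not> is_guess (P (t + d))" using le_Suc_ex by blast
  then show ?thesis using assms
  proof (induction d arbitrary: t)
    case 0
    then show ?case unfolding is_guess_def by auto
  next
    case (Suc d)
    from run_step[of t] Suc.prems(2) have S1: "S (Suc t) = (S t)(r := Suc (S t r))"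
      and "P (Suc t) = Some (Guess r # k) \<or> P (Suc t) = Some k"
      by (auto simp: mstep_def)
    from this(2) show ?case
    proof
      assume "P (Suc t) = Some (Guess r # k)"
      moreover have "\<not> is_guess (P (Suc t + d))" using Suc.prems(1) by simp
      ultimately obtain t' j where
        "t' \<ge> Suc t" "P t' = Some k" "S t' = (S (Suc t))(r := S (Suc t) r + Suc j)"
        using Suc.IH by blast
      then show ?thesis using S1
        by (intro exI[of _ t'] conjI exI[of _ "Suc j"]) (auto simp: fun_eq_iff)
    next
      assume "P (Suc t) = Some k"
      then show ?thesis using S1 by (intro exI[of _ "Suc t"] conjI exI[of _ 0]) (auto simp: fun_eq_iff)
    qed
  qed
qed

lemma run_head:
  assumes "at_head n c (P t, S t)"
  shows "\<exists>c' t'. T n c c' = 0 \<and> at_head n c' (P t', S t')"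
proof -
  have s: "S t 0 = n" "S t 1 = c" "S t 2 = 0" "S t 3 = 1" "P t = Some loop"
    using assms unfolding at_head_def by auto
  from run_dsteps[OF r_into_rtranclp[of dstep, OF dstep_loop[of "S t"]] s(5)] s
  obtain t1 where t1: "P t1 = Some (Guess 2 # test @ loop)" "S t1 = S t" by auto
  from run_guess[OF this(1)] obtain t2 j where t2: "P t2 = Some (test @ loop)" "S t2 = (S t)(2 := Suc j)"
    using t1(2) s by auto
  obtain s' where s': "dstep\<^sup>*\<^sup>* (test @ loop, S t2) (loop, s')" "T n c (Suc j) \<noteq> 0 \<Longrightarrow> s' 3 = 0"
    "T n c (Suc j) = 0 \<Longrightarrow> at_head n (Suc j) (Some loop, s')"
    by (rule dsteps_test[of "S t2" n c "Suc j"]) (use s t2 in auto)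
  from run_dsteps[OF s'(1) t2(1)] obtain t3 where t3: "P t3 = Some loop" "S t3 = s'" by auto
  show ?thesis
  proof (cases "T n c (Suc j) = 0")
    case True
    then show ?thesis using s'(3) t3 by metis
  next
    case False
    from run_dsteps[OF r_into_rtranclp[of dstep, OF dstep_loop_exit[of s']] t3] s'(2)[OF False]
    obtain t4 where "P t4 = Some []" by auto
    then have False using run_step[of t4] by (simp add: mstep_def)
    then show ?thesis ..
  qed
qed

lemma chain_if_fair_run: "\<exists>c. c 0 = 0 \<and> (\<forall>i. T n (c i) (c (Suc i)) = 0)"
proof -
  have "P 0 = None" "S 0 = input n" using run unfolding fair_run_def by auto
  then have "P 1 = Some prog" "S 1 = input n" using run_step[of 0] by (auto simp: mstep_def)
  then have "at_head n 0 (P 2, S 2)" using run_step[of 1]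
    by (auto simp: mstep_def prog_def at_head_def input_def numeral_2_eq_2)
  then have base: "\<exists>t. at_head n 0 (P t, S t)" by blast
  have "\<exists>c. \<forall>i. ((\<exists>t. at_head n (c i) (P t, S t)) \<and> (i = 0 \<longrightarrow> c i = 0)) \<and> T n (c i) (c (Suc i)) = 0"
    by (rule dependent_nat_choice[of "\<lambda>i c. (\<exists>t. at_head n c (P t, S t)) \<and> (i = 0 \<longrightarrow> c = 0)"
          "\<lambda>i c c'. T n c c' = 0"]) (use base run_head in blast)+
  then show ?thesis by blast
qed

end

lemma fair_run_iff: "(\<exists>P S. fair_run prog n P S) \<longleftrightarrow> (\<exists>c. c 0 = 0 \<and> (\<forall>i. T n (c i) (c (Suc i)) = 0))"
  using fair_run_if_chain chain_if_fair_run by blast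

end

section \<open>Normal form by infinite chains of numbers\<close>

text \<open>Codes of reversed lists make one-element extension a matter of a single pairing.\<close>

definition code_rev_step :: "nat \<Rightarrow> nat" where
  "code_rev_step p = (let a = fst (prod_decode p); b = snd (prod_decode p) in
     if a = 0 then p else prod_encode (snd (prod_decode (a - 1)), Suc (prod_encode (fst (prod_decode (a - 1)), b))))"

text \<open>The code of a list bounds its length, so \<open>u\<close> rounds suffice; rounds after
  the list is used up change nothing.\<close>

definition code_rev :: "nat \<Rightarrow> nat" where
  "code_rev u = snd (prod_decode (rec_nat (prod_encode (u, 0)) (\<lambda>_. code_rev_step) u))"

lemma length_le_list_encode: "length l \<le> list_encode l"
proof (induction l)
  case (Cons x l)
  then show ?case using le_prod_encode_2[of "list_encode l" x] by simp
qed simp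

lemma code_rev_encode: "code_rev (list_encode l) = list_encode (rev l)"
proof -
  have *: "rec_nat (prod_encode (list_encode l, 0)) (\<lambda>_. code_rev_step) m
      = prod_encode (list_encode (drop m l), list_encode (rev (take m l)))" for m
  proof (induction m)
    case (Suc m)
    show ?case
    proof (cases "m < length l")
      case True
      then show ?thesis
        using Suc Cons_nth_drop_Suc[OF True, symmetric] take_Suc_conv_app_nth[OF True]
        by (simp add: code_rev_step_def)
    next
      case False
      then show ?thesis using Suc by (simp add: code_rev_step_def)
    qed
  qed simp
  show ?thesis unfolding code_rev_def * using length_le_list_encode[of l] by simp
qed

lemma rec_fun_code_rev:
  assumes "rec_fun k f"
  shows "rec_fun k (\<lambda>xs. code_rev (f xs))"
proof -
  have "rec_fun (Suc (Suc k)) (\<lambda>xs. code_rev_step (xs ! 0))"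
    unfolding code_rev_step_def Let_def
    by (intro rec_fun_if rec_pred_eq_0 rec_fun_prod_encode rec_fun_Suc rec_fun_fst_prod_decode rec_fun_snd_prod_decode rec_fun_pred rec_fun_proj; simp)
  then show ?thesis unfolding code_rev_def
    by (intro rec_fun_snd_prod_decode rec_fun_rec rec_fun_prod_encode rec_fun_const assms)
qed

text \<open>The chain consists of the codes of the reversed initial segments of \<alpha>, from 0,
  the code of the empty list. A step checks that exactly one element was added and that
  \<open>R\<close> accepts the old segment, so an infinite chain has tested every segment.\<close>

lemma Sigma11_chain:
  assumes "Sigma11 A"
  obtains T e where "\<And>n c c'. eval_recf e [n, c, c'] (T n c c')" "\<And>n c. T n c 0 \<noteq> 0"
    "\<And>n. n \<in> A \<longleftrightarrow> (\<exists>c. c 0 = 0 \<and> (\<forall>i. T n (c i) (c (Suc i)) = 0))"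
proof -
  obtain R where R: "computable2 R"
    "\<And>n. n \<in> A \<longleftrightarrow> (\<exists>\<alpha>. \<forall>m. R n (list_encode (map \<alpha> [0..<m])) = 0)"
    using assms unfolding Sigma11_def by blast
  define T where "T n c c' = (if c' = 0 \<or> snd (prod_decode (c' - 1)) \<noteq> c then 1 else R n (code_rev c))" for n c c'
  have "rec_fun 3 (\<lambda>xs. T (xs ! 0) (xs ! 1) (xs ! 2))"
    unfolding T_def
    by (intro rec_fun_if rec_pred_disj rec_pred_eq_0 rec_pred_not rec_pred_eq rec_fun_snd_prod_decode rec_fun_pred rec_fun_const rec_fun_code_rev
        rec_fun_comp2[OF R(1)] rec_fun_proj; simp)
  then obtain e where e: "\<And>xs. length xs = 3 \<Longrightarrow> eval_recf e xs (T (xs ! 0) (xs ! 1) (xs ! 2))"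
    unfolding rec_fun_def by blast
  have "eval_recf e [n, c, c'] (T n c c')" for n c c' using e[of "[n, c, c']"] by simp
  moreover have "T n c 0 \<noteq> 0" for n c unfolding T_def by simp
  moreover have "n \<in> A \<longleftrightarrow> (\<exists>c. c 0 = 0 \<and> (\<forall>i. T n (c i) (c (Suc i)) = 0))" for n
  proof
    assume "n \<in> A"
    then obtain \<alpha> where \<alpha>: "\<And>m. R n (list_encode (map \<alpha> [0..<m])) = 0" using R(2) by blast
    define c where "c i = list_encode (rev (map \<alpha> [0..<i]))" for i
    have "T n (c i) (c (Suc i)) = 0" for i
      using \<alpha>[of i] unfolding T_def c_def by (simp add: code_rev_encode)
    then show "\<exists>c. c 0 = 0 \<and> (\<forall>i. T n (c i) (c (Suc i)) = 0)"
      by (intro exI[of _ c]) (simp add: c_def)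
  next
    assume "\<exists>c. c 0 = 0 \<and> (\<forall>i. T n (c i) (c (Suc i)) = 0)"
    then obtain c where c: "c 0 = 0" "\<And>i. T n (c i) (c (Suc i)) = 0" by blast
    \<comment> \<open>The head of the list coded by \<open>c (Suc i)\<close>; in a reversed list
      this is the element added last.\<close>
    define \<alpha> where "\<alpha> i = fst (prod_decode (c (Suc i) - 1))" for i
    have "c i = list_encode (rev (map \<alpha> [0..<i]))" for i
    proof (induction i)
      case (Suc i)
      from c(2)[of i] have "c (Suc i) \<noteq> 0" "snd (prod_decode (c (Suc i) - 1)) = c i"
        unfolding T_def by (auto split: if_splits)
      then have "c (Suc i) = Suc (prod_encode (\<alpha> i, c i))" unfolding \<alpha>_def
        by (metis Suc_pred' diff_Suc_1 not_gr_zero prod.collapse prod_decode_inverse)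
      then show ?case using Suc by simp
    qed (simp add: c)
    then have "R n (list_encode (map \<alpha> [0..<i])) = 0" for i
      using c(2)[of i] unfolding T_def by (simp add: code_rev_encode split: if_splits)
    then show "n \<in> A" using R(2) by blast
  qed
  ultimately show ?thesis by (rule that)
qed

section \<open>Tilings and markings\<close>

text \<open>The control points reachable from \<open>ps @ k\<close> before \<open>k\<close> is left.\<close>

fun conts :: "com list \<Rightarrow> com list \<Rightarrow> com list set" where
  "conts [] k = {k}"
| "conts (Wh r p # ps) k = insert (Wh r p # ps @ k) (conts p (Wh r p # ps @ k) \<union> conts ps k)"
| "conts (Inc r # ps) k = insert (Inc r # ps @ k) (conts ps k)"
| "conts (Dec r # ps) k = insert (Dec r # ps @ k) (conts ps k)"
| "conts (Guess r # ps) k = insert (Guess r # ps @ k) (conts ps k)"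

lemma finite_conts: "finite (conts ps k)"
  by (induction ps k rule: conts.induct) auto

lemma conts_start: "ps @ k \<in> conts ps k"
  by (cases "(ps, k)" rule: conts.cases) auto

text \<open>Loop bodies are unfolded in front of the continuation; this closure shows that the
  control points nevertheless stay in a finite set, as tiles require.\<close>

lemma conts_nxt:
  "l \<in> conts ps k \<Longrightarrow> l \<noteq> k \<Longrightarrow> q \<in> nxt p0 (Some l) Z \<Longrightarrow> q \<in> Some ` conts ps k"
proof (induction ps k arbitrary: l rule: conts.induct)
  case (2 r p ps k)
  let ?w = "Wh r p # ps @ k"
  consider "l = ?w" | "l \<in> conts p ?w" "l \<noteq> ?w" | "l \<in> conts ps k" using 2 by auto
  then show ?case
  proof cases
    case 1
    then have "q = Some (p @ ?w) \<or> q = Some (ps @ k)" using 2(5) by (auto split: if_splits)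
    then show ?thesis using conts_start by auto
  next
    case 2
    then show ?thesis using "2.IH"(1) "2.prems" by auto
  next
    case 3
    then show ?thesis using "2.IH"(2) "2.prems" by auto
  qed
qed (auto simp: conts_start)

text \<open>\<open>Bd\<close> tiles form the left boundary column of the quadrant. An \<open>In\<close> tile at distance \<open>x + 1\<close> from it holds
  the registers with value greater than \<open>x\<close>; every tile of a row knows the control point.\<close>

datatype tile = Blank | Bd pc | In pc "nat set"

text \<open>\<open>Cl t m s\<close> is a tile \<open>t\<close> with mark \<open>m\<close> (0: none, 1: absence of a seed, 2: guessing forever) at stage \<open>s\<close>.\<close>

datatype cell = Er bool | Cl tile nat nat

fun tile_of :: "cell \<Rightarrow> tile" where
  "tile_of (Er b) = Blank"
| "tile_of (Cl t m s) = t"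

fun mark_of :: "cell \<Rightarrow> nat" where
  "mark_of (Er b) = 0"
| "mark_of (Cl t m s) = m"

text \<open>For \<open>Inc\<close>, a tile copies the bit of its left neighbour; in the first column that bit is 1.\<close>

fun tbits :: "tile \<Rightarrow> nat set" where
  "tbits Blank = {}"
| "tbits (Bd p) = UNIV"
| "tbits (In p b) = b"

text \<open>A register is the set of columns below its value, so \<open>Inc\<close> shifts its bits
  to the right and \<open>Dec\<close> to the left.\<close>

fun upd :: "pc \<Rightarrow> nat set \<Rightarrow> nat set \<Rightarrow> nat set \<Rightarrow> nat set" where
  "upd (Some (Inc r # k)) w b e = (if r \<in> w then insert r b else b - {r})"
| "upd (Some (Guess r # k)) w b e = (if r \<in> w then insert r b else b - {r})"
| "upd (Some (Dec r # k)) w b e = (if r \<in> e then insert r b else b - {r})"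
| "upd _ w b e = b"

text \<open>Above an \<open>In\<close> tile the control point is left open; it agrees with the
  choice made in the boundary column because the next row copies it from left to right. The bits
  next to \<open>Bd\<close> are the nonzero registers, which is what \<open>nxt\<close>
  tests.\<close>

fun tile_ok :: "com list \<Rightarrow> tile \<Rightarrow> tile \<Rightarrow> tile \<Rightarrow> tile \<Rightarrow> bool" where
  "tile_ok p0 Blank e w u \<longleftrightarrow> True"
| "tile_ok p0 (Bd p) e w u \<longleftrightarrow> (\<exists>b p'. e = In p b \<and> p' \<in> nxt p0 p b \<and> u = Bd p')"
| "tile_ok p0 (In p b) e w u \<longleftrightarrow> (\<exists>be p'. e = In p be \<and> u = In p' (upd p (tbits w) b be))"

text \<open>Mark 1 can only fill the whole plane, which a seed tile forbids. Mark 2 is forced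
  upwards along guessing boundary tiles, so it fits only into a column that guesses forever.\<close>

definition mark_ok :: "tile \<Rightarrow> nat \<Rightarrow> nat \<Rightarrow> nat \<Rightarrow> nat \<Rightarrow> nat \<Rightarrow> bool" where
  "mark_ok t m me mw mu md \<longleftrightarrow> m = 0
     \<or> m = 1 \<and> t \<noteq> Bd None \<and> me = 1 \<and> mw = 1 \<and> mu = 1 \<and> md = 1
     \<or> m = 2 \<and> (\<exists>p. t = Bd p \<and> is_guess p) \<and> mu = 2"

definition cell_ok :: "com list \<Rightarrow> cell \<Rightarrow> cell \<Rightarrow> cell \<Rightarrow> cell \<Rightarrow> cell \<Rightarrow> bool" where
  "cell_ok p0 c e w u d \<longleftrightarrow> tile_ok p0 (tile_of c) (tile_of e) (tile_of w) (tile_of u)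
     \<and> mark_ok (tile_of c) (mark_of c) (mark_of e) (mark_of w) (mark_of u) (mark_of d)"

fun cell_step :: "bool \<Rightarrow> cell \<Rightarrow> cell" where
  "cell_step k (Er b) = Er (\<not> b)"
| "cell_step k (Cl t m s) = (if k then if s > 0 then Cl t m 0 else Cl t 0 0 else Er False)"

text \<open>\<open>Bd None\<close> and \<open>In None {0}\<close> are left out on purpose: only the
  special states from \<open>K\<close> on look like them, so ordinary cells cannot fake a seed or an
  input.\<close>

definition tiles :: "com list set \<Rightarrow> nat set \<Rightarrow> tile set" where
  "tiles CS RS = {Blank, In None {}} \<union> (\<lambda>l. Bd (Some l)) ` CS \<union> (\<lambda>(l, b). In (Some l) b) ` (CS \<times> Pow RS)"

definition cells :: "com list set \<Rightarrow> nat set \<Rightarrow> cell set" where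
  "cells CS RS = range Er \<union> (\<lambda>(t, m, s). Cl t m s) ` (tiles CS RS \<times> {..<3} \<times> {..<4})"

lemma finite_cells: "finite CS \<Longrightarrow> finite RS \<Longrightarrow> finite (cells CS RS)"
  unfolding cells_def tiles_def by auto

lemma Er_in_cells: "Er b \<in> cells CS RS"
  unfolding cells_def by auto

lemma Cl_in_cells: "Cl t m s \<in> cells CS RS \<longleftrightarrow> t \<in> tiles CS RS \<and> m < 3 \<and> s < 4"
  unfolding cells_def by (auto intro!: image_eqI[of _ _ "(t, m, s)"])

definition bits :: "nat set \<Rightarrow> (nat \<Rightarrow> nat) \<Rightarrow> nat \<Rightarrow> nat set" where
  "bits RS s x = {r \<in> RS. s r > x}"

fun head_reg :: "com list \<Rightarrow> nat" where
  "head_reg (Inc r # k) = r"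
| "head_reg (Dec r # k) = r"
| "head_reg (Wh r p # k) = r"
| "head_reg (Guess r # k) = r"
| "head_reg [] = 0"

text \<open>The states of the automaton for input \<open>n\<close> are the numbers up to \<open>K + n\<close>: those below \<open>K\<close> encode the cells through
  \<open>D\<close>, and \<open>K + n, \<dots>, K\<close> must follow each other from left to right, starting with the seed \<open>K + n\<close> and
  followed by \<open>K - 1\<close>. This writes the input into register 0 in the first row, since \<open>K, \<dots>, K + n - 1\<close> all
  look like the tile \<open>In None {0}\<close>. These states, in particular the seed, cannot be marked.\<close>

locale ca =
  fixes p0 :: "com list" and CS :: "com list set" and RS :: "nat set"
    and K n :: nat and D :: "nat \<Rightarrow> cell"
  assumes p0_CS: "p0 \<in> CS"
    and nxt_CS: "\<And>l q Z. l \<in> CS \<Longrightarrow> q \<in> nxt p0 (Some l) Z \<Longrightarrow> q \<in> Some ` CS"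
    and RS: "\<And>l. l \<in> CS \<Longrightarrow> head_reg l \<in> RS" "0 \<in> RS"
    and D_bij: "bij_betw D {..<K} (cells CS RS)"
    and D_zero: "D (K - 1) = Cl (In None {}) 0 0"
    and D_one: "D K = Cl (In None {0}) 0 0"
    and D_seed: "D (Suc K) = Cl (Bd None) 0 0"
begin

definition enc :: "cell \<Rightarrow> nat" where
  "enc = inv_into {..<K} D"

text \<open>Collapses the states to \<open>K + 2\<close> representatives, so that the tile
  conditions become a finite table common to all inputs.\<close>

definition proj :: "nat \<Rightarrow> nat" where
  "proj s = (if s < K then s else if s < K + n then K else Suc K)"

definition view :: "nat \<Rightarrow> cell" where
  "view s = D (proj s)"

text \<open>Compares numbers of states rather than tiles, since \<open>K, ..., K + n - 1\<close> all
  look alike. The seed has no western requirement, so the chain starts there.\<close>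

definition chain_ok :: "nat \<Rightarrow> nat \<Rightarrow> nat \<Rightarrow> bool" where
  "chain_ok c e w \<longleftrightarrow> (K \<le> c \<longrightarrow> e = c - 1) \<and> (K \<le> c \<and> c < K + n \<longrightarrow> w = Suc c)"

definition rule_ok :: "nat \<Rightarrow> nat \<Rightarrow> nat \<Rightarrow> nat \<Rightarrow> nat \<Rightarrow> bool" where
  "rule_ok c e w u d \<longleftrightarrow> chain_ok c e w \<and> cell_ok p0 (view c) (view e) (view w) (view u) (view d)"

definition rule :: "nat \<Rightarrow> nat \<Rightarrow> nat \<Rightarrow> nat \<Rightarrow> nat \<Rightarrow> nat" where
  "rule c e w u d = (if c < K then enc (cell_step (rule_ok c e w u d) (D c))
     else if rule_ok c e w u d then c else enc (Er False))"

fun ok_at :: "(int \<times> int \<Rightarrow> nat) \<Rightarrow> int \<times> int \<Rightarrow> bool" where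
  "ok_at x (i, j) \<longleftrightarrow> rule_ok (x (i, j)) (x (i + 1, j)) (x (i - 1, j)) (x (i, j + 1)) (x (i, j - 1))"

fun Fm :: "(int \<times> int \<Rightarrow> nat) \<Rightarrow> int \<times> int \<Rightarrow> nat" where
  "Fm x (i, j) = rule (x (i, j)) (x (i + 1, j)) (x (i - 1, j)) (x (i, j + 1)) (x (i, j - 1))"

lemma K_pos: "K \<ge> 1"
  using bij_betw_imp_surj_on[OF D_bij] Er_in_cells[of True CS RS] by (cases K) auto

lemma enc_less: "q \<in> cells CS RS \<Longrightarrow> enc q < K"
  unfolding enc_def using bij_betw_imp_surj_on[OF D_bij] inv_into_into[of q D "{..<K}"] by auto

lemma D_enc: "q \<in> cells CS RS \<Longrightarrow> D (enc q) = q"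
  unfolding enc_def using bij_betw_imp_surj_on[OF D_bij] f_inv_into_f[of q D "{..<K}"] by auto

lemma enc_D: "s < K \<Longrightarrow> enc (D s) = s"
  unfolding enc_def using bij_betw_imp_inj_on[OF D_bij] inv_into_f_f[of D "{..<K}" s] by auto

lemma D_cells: "s < K \<Longrightarrow> D s \<in> cells CS RS"
  using bij_betw_imp_surj_on[OF D_bij] by auto

lemma view_less: "s < K \<Longrightarrow> view s = D s"
  unfolding view_def proj_def by simp

lemma view_enc: "q \<in> cells CS RS \<Longrightarrow> view (enc q) = q"
  using view_less enc_less D_enc by simp

lemma view_chain: "K \<le> s \<Longrightarrow> s < K + n \<Longrightarrow> view s = Cl (In None {0}) 0 0"
  unfolding view_def proj_def using D_one by simp

lemma view_seed: "K + n \<le> s \<Longrightarrow> view s = Cl (Bd None) 0 0"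
  unfolding view_def proj_def using D_seed by simp

lemma view_zero: "view (K - 1) = Cl (In None {}) 0 0"
  using view_less[of "K - 1"] K_pos D_zero by simp

lemma view_ge: "K \<le> s \<Longrightarrow> \<exists>t. view s = Cl t 0 0"
  using view_chain view_seed by (metis not_le)

lemma rule_ge: "K \<le> c \<Longrightarrow> rule_ok c e w u d \<Longrightarrow> rule c e w u d = c"
  unfolding rule_def by simp

lemma rule_less:
  assumes "c < K" "view c = Cl t m s" "rule_ok c e w u d"
  shows "rule c e w u d = enc (if s > 0 then Cl t m 0 else Cl t 0 0)"
  using assms view_less[of c] unfolding rule_def by simp

text \<open>A step read backwards: errors only produce errors, and no clause of
  \<open>cell_step\<close> yields a nonzero stage. Thus a configuration with a preimage has no cell
  at stages 1 to 3.\<close>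

lemma rule_cell:
  assumes "view (rule c e w u d) = Cl t m s"
  shows "rule_ok c e w u d" "s = 0" "\<exists>m' s'. view c = Cl t m' s' \<and> m = (if s' > 0 then m' else 0)"
proof -
  have ok: "rule_ok c e w u d \<and> (c < K \<longrightarrow> (\<exists>t' m' s'. D c = Cl t' m' s'))"
  proof (rule ccontr)
    assume "\<not> ?thesis"
    then obtain b where "rule c e w u d = enc (Er b)"
      unfolding rule_def by (cases "c < K"; cases "D c") auto
    then show False using assms view_enc[OF Er_in_cells[of b]] by simp
  qed
  show "rule_ok c e w u d" using ok by simp
  show "s = 0" "\<exists>m' s'. view c = Cl t m' s' \<and> m = (if s' > 0 then m' else 0)"
  proof -
    have "s = 0 \<and> (\<exists>m' s'. view c = Cl t m' s' \<and> m = (if s' > 0 then m' else 0))"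
    proof (cases "c < K")
      case True
      then obtain t' m' s' where D: "D c = Cl t' m' s'" using ok by blast
      then have "Cl t' m' s' \<in> cells CS RS" using D_cells[OF True] by simp
      then have "(if s' > 0 then Cl t' m' 0 else Cl t' 0 0) \<in> cells CS RS"
        by (simp add: Cl_in_cells)
      then have "view (rule c e w u d) = (if s' > 0 then Cl t' m' 0 else Cl t' 0 0)"
        using view_enc rule_less[OF True, of t' m' s' e w u d] ok D view_less[OF True] by simp
      then show ?thesis using assms D view_less[OF True] by (auto split: if_splits)
    next
      case False
      then show ?thesis using assms rule_ge[of c e w u d] view_ge[of c] ok by auto
    qed
    then show "s = 0" "\<exists>m' s'. view c = Cl t m' s' \<and> m = (if s' > 0 then m' else 0)" by blast+
  qed
qed

text \<open>The first column is separate: its left neighbour is the boundary, where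
  \<open>tbits\<close> is \<open>UNIV\<close>, so that \<open>Inc\<close> makes a zero register
  positive.\<close>

lemma bits_upd:
  assumes "p \<in> Some ` CS \<or> p = None"
  shows "bits RS (act p s) 0 = upd p UNIV (bits RS s 0) (bits RS s 1)"
    "bits RS (act p s) (Suc x) = upd p (bits RS s x) (bits RS s (Suc x)) (bits RS s (Suc (Suc x)))"
proof -
  have "bits RS (act p s) 0 = upd p UNIV (bits RS s 0) (bits RS s 1) \<and>
    bits RS (act p s) (Suc x) = upd p (bits RS s x) (bits RS s (Suc x)) (bits RS s (Suc (Suc x)))"
  proof (cases p)
    case None
    then show ?thesis by simp
  next
    case (Some l)
    then have "head_reg l \<in> RS" using assms RS by auto
    then show ?thesis unfolding Some
      by (cases l rule: head_reg.cases) (auto simp: bits_def split: if_splits)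
  qed
  then show "bits RS (act p s) 0 = upd p UNIV (bits RS s 0) (bits RS s 1)"
    "bits RS (act p s) (Suc x) = upd p (bits RS s x) (bits RS s (Suc x)) (bits RS s (Suc (Suc x)))"
    by blast+
qed

lemma nxt_bits:
  assumes "p \<in> Some ` CS \<or> p = None"
  shows "nxt p0 p (bits RS s 0) = nxt p0 p {r. s r \<noteq> 0}"
proof (cases p)
  case (Some l)
  then have "head_reg l \<in> RS" using assms RS by auto
  then show ?thesis unfolding Some by (cases l rule: head_reg.cases) (auto simp: bits_def)
qed simp

lemma nxt_in_CS:
  assumes "p \<in> Some ` CS \<or> p = None" "q \<in> nxt p0 p Z"
  shows "q \<in> Some ` CS"
  using assms nxt_CS p0_CS by auto

lemma bits_input: "bits RS (input n) x = (if x < n then {0} else {})"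
  unfolding bits_def input_def using RS by auto

lemma rule_same:
  assumes "rule_ok c e w u d" "view c = Cl t m s"
  shows "rule c e w u d = (if K \<le> c then c else if s > 0 then enc (Cl t m 0) else enc (Cl t 0 0))"
  using rule_ge rule_less assms by auto

lemma rule_okD:
  assumes "rule_ok c e w u d"
  shows "K \<le> c \<Longrightarrow> e = c - 1" "K \<le> c \<Longrightarrow> c < K + n \<Longrightarrow> w = Suc c"
    "tile_ok p0 (tile_of (view c)) (tile_of (view e)) (tile_of (view w)) (tile_of (view u))"
    "mark_ok (tile_of (view c)) (mark_of (view c)) (mark_of (view e)) (mark_of (view w))
       (mark_of (view u)) (mark_of (view d))"
  using assms unfolding rule_ok_def chain_ok_def cell_ok_def by auto

definition sat :: bool where
  "sat \<longleftrightarrow> (\<exists>y. is_config (Suc (K + n)) y \<and> Fm y = y \<and>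
     (\<forall>y' y1 y2 y3. is_config (Suc (K + n)) y' \<and> is_config (Suc (K + n)) y1 \<and>
        is_config (Suc (K + n)) y2 \<and> is_config (Suc (K + n)) y3 \<longrightarrow>
          (y' \<noteq> y \<and> Fm y' = y \<and> Fm y1 = y' \<and> Fm y2 = y' \<and> Fm y3 = y') \<longrightarrow>
          (y1 = y2 \<or> y1 = y3 \<or> y2 = y1 \<or> y2 = y3 \<or> y3 = y1 \<or> y3 = y2)))"

section \<open>From a fair run to a fixed point\<close>

context
  fixes P S
  assumes run: "fair_run p0 n P S"
begin

lemma run_mstep: "mstep p0 (P t, S t) (P (Suc t), S (Suc t))"
  using run unfolding fair_run_def by blast

lemma run_CS: "P t \<in> Some ` CS \<or> P t = None"
proof (induction t)
  case 0
  show ?case using run unfolding fair_run_def by simp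
next
  case (Suc t)
  have "P (Suc t) \<in> nxt p0 (P t) {r. S t r \<noteq> 0}" using run_mstep[of t] by (simp add: mstep_def)
  then show ?case using nxt_in_CS[OF Suc] by blast
qed

lemma run_CS_Suc: "P (Suc t) \<in> Some ` CS"
proof -
  have "P (Suc t) \<in> nxt p0 (P t) {r. S t r \<noteq> 0}" using run_mstep[of t] by (simp add: mstep_def)
  then show ?thesis using nxt_in_CS[OF run_CS] by blast
qed

fun run_tile :: "int \<times> int \<Rightarrow> tile" where
  "run_tile (i, j) = (if i < 0 \<or> j < 0 then Blank else if i = 0 then Bd (P (nat j))
     else In (P (nat j)) (bits RS (S (nat j)) (nat i - 1)))"

text \<open>In the row of time 0 the states are the chain \<open>K + n, ..., K\<close> followed by
  \<open>K - 1\<close> all the way to the right; all other cells are ordinary ones without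
  mark.\<close>

fun run_conf :: "int \<times> int \<Rightarrow> nat" where
  "run_conf (i, j) = (if i \<ge> 0 \<and> j = 0 then if nat i \<le> n then K + n - nat i else K - 1
     else enc (Cl (run_tile (i, j)) 0 0))"

lemma run_tile_tiles:
  assumes "\<not> (i \<ge> 0 \<and> j = 0)"
  shows "run_tile (i, j) \<in> tiles CS RS"
proof (cases "i < 0 \<or> j < 0")
  case False
  with assms obtain t where "nat j = Suc t" by (cases "nat j") auto
  moreover have "bits RS (S (nat j)) (nat i - 1) \<subseteq> RS" unfolding bits_def by auto
  ultimately show ?thesis using False run_CS_Suc[of t] unfolding tiles_def by auto
qed (auto simp: tiles_def)

lemma view_run_conf: "view (run_conf (i, j)) = Cl (run_tile (i, j)) 0 0"
proof (cases "i \<ge> 0 \<and> j = 0")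
  case True
  have PS: "P 0 = None" "S 0 = input n" using run unfolding fair_run_def by auto
  consider "i = 0" | "i > 0" "nat i \<le> n" | "i > 0" "nat i > n" using True by linarith
  then show ?thesis
  proof cases
    case 1
    then show ?thesis using True PS view_seed by simp
  next
    case 2
    then have "view (K + n - nat i) = Cl (In None {0}) 0 0" by (intro view_chain) auto
    moreover have "nat i - 1 < n" using 2 by auto
    ultimately show ?thesis using 2 True PS by (simp add: bits_input)
  next
    case 3
    moreover from this have "\<not> nat i - 1 < n" by auto
    ultimately show ?thesis using True PS view_zero by (simp add: bits_input)
  qed
next
  case False
  then have "Cl (run_tile (i, j)) 0 0 \<in> cells CS RS"
    using run_tile_tiles[OF False] by (simp add: Cl_in_cells)
  then have "view (enc (Cl (run_tile (i, j)) 0 0)) = Cl (run_tile (i, j)) 0 0" by (rule view_enc)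
  then show ?thesis using False by (auto simp del: run_tile.simps)
qed

lemma run_tile_ok:
  "tile_ok p0 (run_tile (i, j)) (run_tile (i + 1, j)) (run_tile (i - 1, j)) (run_tile (i, j + 1))"
proof (cases "i < 0 \<or> j < 0")
  case False
  define t where "t = nat j"
  have j: "nat (j + 1) = Suc t" "nat j = t" using False t_def by auto
  have nxt: "P (Suc t) \<in> nxt p0 (P t) (bits RS (S t) 0)" and S: "S (Suc t) = act (P t) (S t)"
    using run_mstep[of t] nxt_bits[OF run_CS] unfolding mstep_def by auto
  consider "i = 0" | "i = 1" | x where "nat i = Suc (Suc x)" "i > 1"
    using False by (cases "nat i"; cases "nat i - 1") auto
  then show ?thesis
  proof cases
    case 3
    then have "nat (i + 1) - 1 = Suc (Suc x)" "nat (i - 1) - 1 = x" by auto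
    then show ?thesis using 3 False j bits_upd(2)[OF run_CS] S by simp
  qed (use False j nxt S bits_upd(1)[OF run_CS] in auto)
qed simp

lemma run_ok_at: "ok_at run_conf (i, j)"
proof -
  have "chain_ok (run_conf (i, j)) (run_conf (i + 1, j)) (run_conf (i - 1, j))"
  proof (cases "i \<ge> 0 \<and> j = 0 \<and> nat i \<le> n")
    case True
    have K: "K \<ge> 1" by (rule K_pos)
    have "nat (i + 1) = Suc (nat i)" using True by auto
    moreover have "nat i = Suc (nat (i - 1))" "i - 1 \<ge> 0" if "nat i \<noteq> 0" using that by auto
    ultimately show ?thesis using True K unfolding chain_ok_def by (cases "nat i = 0"; auto; arith)
  next
    case False
    have "run_conf (i, j) < K"
    proof (cases "i \<ge> 0 \<and> j = 0")
      case True
      then show ?thesis using False K_pos by auto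
    next
      case False
      then have "Cl (run_tile (i, j)) 0 0 \<in> cells CS RS"
        using run_tile_tiles[OF False] by (simp add: Cl_in_cells)
      then have "enc (Cl (run_tile (i, j)) 0 0) < K" by (rule enc_less)
      then show ?thesis using False by (auto simp del: run_tile.simps)
    qed
    then show ?thesis unfolding chain_ok_def by simp
  qed
  then show ?thesis using run_tile_ok
    by (simp add: rule_ok_def cell_ok_def view_run_conf mark_ok_def del: run_tile.simps run_conf.simps)
qed

lemma run_conf_config: "is_config (Suc (K + n)) run_conf"
  unfolding is_config_def
proof
  fix v :: "int \<times> int"
  obtain i j where v: "v = (i, j)" by (cases v)
  show "run_conf v < Suc (K + n)"
  proof (cases "i \<ge> 0 \<and> j = 0")
    case True
    then show ?thesis using v by auto
  next
    case False
    then have "Cl (run_tile (i, j)) 0 0 \<in> cells CS RS"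
      using run_tile_tiles[OF False] by (simp add: Cl_in_cells)
    then have "enc (Cl (run_tile (i, j)) 0 0) < K" by (rule enc_less)
    then show ?thesis using False v by (auto simp del: run_tile.simps)
  qed
qed

lemma fixed_step:
  assumes "rule_ok c e w u d" "view c = Cl t 0 0"
  shows "rule c e w u d = c"
  using rule_same[OF assms] enc_D[of c] view_less[of c] assms(2) by auto

lemma run_conf_fixed: "Fm run_conf = run_conf"
proof
  fix v :: "int \<times> int"
  obtain i j where v: "v = (i, j)" by (cases v)
  have "rule_ok (run_conf (i, j)) (run_conf (i + 1, j)) (run_conf (i - 1, j)) (run_conf (i, j + 1)) (run_conf (i, j - 1))"
    using run_ok_at[of i j] by (simp only: ok_at.simps)
  from fixed_step[OF this view_run_conf] show "Fm run_conf v = run_conf v"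
    unfolding v Fm.simps .
qed

lemma spread:
  fixes m :: "int \<times> int \<Rightarrow> nat"
  assumes "m (i0, j0) = 1" and nbr: "\<And>i j. m (i, j) = 1 \<Longrightarrow>
      m (i + 1, j) = 1 \<and> m (i - 1, j) = 1 \<and> m (i, j + 1) = 1 \<and> m (i, j - 1) = 1"
  shows "m (i, j) = 1"
proof -
  have "m (i, j0) = 1"
    by (induction i rule: int_induct[of _ i0]) (use assms(1) nbr in auto)
  then show ?thesis
    by (induction j rule: int_induct[of _ j0]) (use nbr in auto)
qed

text \<open>More than the formula asks: a single preimage \<open>y1\<close> forces stage 0
  throughout \<open>y'\<close>, which can then differ from \<open>run_conf\<close> in its marks
  only. Mark 1 would spread to the seed, and mark 2 would climb past a time without
  guessing.\<close>

lemma run_conf_unique: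
  assumes y': "Fm y' = run_conf" and y1: "Fm y1 = y'"
  shows "y' = run_conf"
proof -
  define m where "m v = mark_of (view (y' v))" for v
  have cell: "view (y' (i, j)) = Cl (run_tile (i, j)) (m (i, j)) 0" "ok_at y' (i, j)" for i j
  proof -
    have "view (Fm y' (i, j)) = Cl (run_tile (i, j)) 0 0" using y' view_run_conf by simp
    from rule_cell[OF this[unfolded Fm.simps]] obtain m' s' where
      *: "view (y' (i, j)) = Cl (run_tile (i, j)) m' s'" "ok_at y' (i, j)" by auto
    have "view (Fm y1 (i, j)) = Cl (run_tile (i, j)) m' s'" using *(1) y1 by simp
    from rule_cell(2)[OF this[unfolded Fm.simps]] have "s' = 0" .
    then show "view (y' (i, j)) = Cl (run_tile (i, j)) (m (i, j)) 0" "ok_at y' (i, j)"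
      using * unfolding m_def by auto
  qed
  have mark: "mark_ok (run_tile (i, j)) (m (i, j)) (m (i + 1, j)) (m (i - 1, j)) (m (i, j + 1)) (m (i, j - 1))" for i j
    using rule_okD(4)[OF cell(2)[of i j, unfolded ok_at.simps]] cell(1) by (simp del: run_tile.simps)
  have not1: "m (i, j) \<noteq> 1" for i j
  proof
    assume "m (i, j) = 1"
    then have "m (0, 0) = 1"
    proof (rule spread)
      show "m (i + 1, j) = 1 \<and> m (i - 1, j) = 1 \<and> m (i, j + 1) = 1 \<and> m (i, j - 1) = 1"
        if "m (i, j) = 1" for i j
        using mark[of i j] that unfolding mark_ok_def by (simp del: run_tile.simps)
    qed
    then have "run_tile (0, 0) \<noteq> Bd None" using mark[of 0 0] by (simp add: mark_ok_def)
    then show False using run unfolding fair_run_def by simp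
  qed
  have not2: "m (i, j) \<noteq> 2" for i j
  proof
    assume m2: "m (i, j) = 2"
    have two: "i' = 0 \<and> j' \<ge> 0 \<and> is_guess (P (nat j')) \<and> m (i', j' + 1) = 2" if "m (i', j') = 2" for i' j'
      using mark[of i' j'] that by (auto simp: mark_ok_def split: if_splits)
    have "m (0, j + int k) = 2" for k
    proof (induction k)
      case 0
      show ?case using m2 two[OF m2] by simp
    next
      case (Suc k)
      from two[OF this] have "m (0, j + int k + 1) = 2" by blast
      then show ?case by (simp only: of_nat_Suc add.assoc add.commute[of 1])
    qed
    then have "is_guess (P (nat j + k))" for k
      using two[of 0 "j + int k"] two[OF m2] by (metis nat_int_add nat_0_le nat_int of_nat_add)
    then show False using run unfolding fair_run_def by (metis le_Suc_ex)
  qed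
  have m0: "m (i, j) = 0" for i j
    using mark[of i j] not1[of i j] not2[of i j] unfolding mark_ok_def by blast
  show ?thesis
  proof
    fix v :: "int \<times> int"
    obtain i j where v: "v = (i, j)" by (cases v)
    have "view (y' (i, j)) = Cl (run_tile (i, j)) 0 0" using cell(1)[of i j] m0 by simp
    from fixed_step[OF cell(2)[of i j, unfolded ok_at.simps] this] show "y' v = run_conf v"
      using y' unfolding v by (metis Fm.simps)
  qed
qed

lemma sat_if_fair_run: "sat"
  unfolding sat_def
  using run_conf_config run_conf_fixed run_conf_unique by blast

end

section \<open>From a fixed point with the required property to a fair run\<close>

context
  fixes y
  assumes conf: "is_config (Suc (K + n)) y" and fixed: "Fm y = y"
    and few: "\<And>y' y1 y2 y3. is_config (Suc (K + n)) y' \<Longrightarrow> is_config (Suc (K + n)) y1 \<Longrightarrow>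
        is_config (Suc (K + n)) y2 \<Longrightarrow> is_config (Suc (K + n)) y3 \<Longrightarrow>
        y' \<noteq> y \<Longrightarrow> Fm y' = y \<Longrightarrow> Fm y1 = y' \<Longrightarrow> Fm y2 = y' \<Longrightarrow> Fm y3 = y' \<Longrightarrow>
          y1 = y2 \<or> y1 = y3 \<or> y2 = y3"
begin

definition yt :: "int \<times> int \<Rightarrow> tile" where
  "yt v = tile_of (view (y v))"

lemma y_le: "y v \<le> K + n"
  using conf[unfolded is_config_def, rule_format, of v] by simp

text \<open>Errors flip, so a fixed point has none. Being its own image it has stage 0 everywhere,
  and marks at stage 0 are erased, so it has none either.\<close>

lemma y_cell: "view (y (i, j)) = Cl (yt (i, j)) 0 0"
  and y_ok: "ok_at y (i, j)"
proof -
  have eq: "rule (y (i, j)) (y (i + 1, j)) (y (i - 1, j)) (y (i, j + 1)) (y (i, j - 1)) = y (i, j)"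
    using fun_cong[OF fixed, of "(i, j)"] by (simp only: Fm.simps)
  obtain t m s where v: "view (y (i, j)) = Cl t m s"
  proof (cases "view (y (i, j))")
    case (Er b)
    then have "y (i, j) < K" using view_ge[of "y (i, j)"] by (cases "y (i, j) < K") auto
    then have "y (i, j) = enc (Er (\<not> b))" using eq Er view_less unfolding rule_def by simp
    then have "view (y (i, j)) = Er (\<not> b)" using view_enc[OF Er_in_cells] by metis
    then show ?thesis using Er by simp
  qed (use that in auto)
  from rule_cell[of "y (i, j)" "y (i + 1, j)" "y (i - 1, j)" "y (i, j + 1)" "y (i, j - 1)", unfolded eq, OF v]
  show "view (y (i, j)) = Cl (yt (i, j)) 0 0" "ok_at y (i, j)" using v by (auto simp: yt_def)
qed

lemmas y_rule_ok = y_ok[unfolded ok_at.simps]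

lemma y_tile_ok: "tile_ok p0 (yt (i, j)) (yt (i + 1, j)) (yt (i - 1, j)) (yt (i, j + 1))"
  using rule_okD(3)[OF y_rule_ok[of i j]] unfolding yt_def .

lemma y_tiles: "y (i, j) < K \<Longrightarrow> yt (i, j) \<in> tiles CS RS"
  using D_cells[of "y (i, j)"] y_cell[of i j] view_less[of "y (i, j)"] by (simp add: Cl_in_cells)

lemma y_enc: "y (i, j) < K \<Longrightarrow> enc (Cl (yt (i, j)) 0 0) = y (i, j)"
  using enc_D[of "y (i, j)"] y_cell[of i j] view_less[of "y (i, j)"] by simp

lemma y_ge_tile: "K \<le> y v \<Longrightarrow> yt v = In None {0} \<or> yt v = Bd None"
  using view_chain[of "y v"] view_seed[of "y v"] unfolding yt_def by (cases "y v < K + n") auto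

text \<open>\<open>X s\<close> is \<open>y\<close> with the marking \<open>m\<close> written onto it
  at stage \<open>s\<close>. If \<open>m\<close> is nonzero somewhere, \<open>X 1\<close>,
  \<open>X 2\<close> and \<open>X 3\<close> are distinct preimages of \<open>X 0\<close>, a preimage
  of \<open>y\<close> other than \<open>y\<close>. Chain states have no marked version and
  \<open>chain_ok\<close> compares the numbers of horizontal neighbours; hence the assumption
  \<open>chain\<close>.\<close>

lemma no_marking:
  fixes m :: "int \<times> int \<Rightarrow> nat"
  assumes m3: "\<And>v. m v < 3"
    and mark: "\<And>i j. mark_ok (yt (i, j)) (m (i, j)) (m (i + 1, j)) (m (i - 1, j)) (m (i, j + 1)) (m (i, j - 1))"
    and chain: "\<And>i j. K \<le> y (i, j) \<Longrightarrow> m (i, j) = 0 \<and> m (i + 1, j) = 0 \<and> m (i - 1, j) = 0"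
  shows "m v = 0"
proof (rule ccontr)
  assume m: "m v \<noteq> 0"
  define X where "X s v = (if m v = 0 then y v else enc (Cl (yt v) (m v) s))" for s v
  have mem: "Cl (yt (i, j)) (m (i, j)) s \<in> cells CS RS" if "m (i, j) \<noteq> 0" "s < 4" for i j s
  proof -
    have "y (i, j) < K" using chain[of i j] that(1) by (cases "K \<le> y (i, j)") auto
    then show ?thesis using that(2) m3 y_tiles[of i j] by (simp add: Cl_in_cells)
  qed
  have view_X: "view (X s (i, j)) = Cl (yt (i, j)) (m (i, j)) (if m (i, j) = 0 then 0 else s)" if "s < 4" for s i j
    using y_cell[of i j] view_enc[OF mem[of i j s]] that unfolding X_def by auto
  have X_ge: "K \<le> X s (i, j) \<Longrightarrow> K \<le> y (i, j) \<and> m (i, j) = 0" if "s < 4" for s i j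
    using enc_less[OF mem[of i j s]] that unfolding X_def by (auto split: if_splits)
  have X_conf: "is_config (Suc (K + n)) (X s)" if "s < 4" for s
    unfolding is_config_def
  proof
    fix v :: "int \<times> int"
    obtain i j where v: "v = (i, j)" by (cases v)
    show "X s v < Suc (K + n)"
      using enc_less[OF mem[of i j s]] y_le[of v] that unfolding X_def v by auto
  qed
  have X_ok: "rule_ok (X s (i, j)) (X s (i + 1, j)) (X s (i - 1, j)) (X s (i, j + 1)) (X s (i, j - 1))"
    if s: "s < 4" for s i j
  proof -
    have "chain_ok (X s (i, j)) (X s (i + 1, j)) (X s (i - 1, j))"
    proof (cases "K \<le> X s (i, j)")
      case True
      then have "K \<le> y (i, j)" using X_ge[OF s] by blast
      then have "X s (i, j) = y (i, j)" "X s (i + 1, j) = y (i + 1, j)" "X s (i - 1, j) = y (i - 1, j)"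
        using chain unfolding X_def by auto
      then show ?thesis using y_rule_ok[of i j] unfolding rule_ok_def by simp
    next
      case False
      then show ?thesis unfolding chain_ok_def by simp
    qed
    then show ?thesis using y_tile_ok mark s unfolding rule_ok_def cell_ok_def by (simp add: view_X)
  qed
  have F_X: "Fm (X s) = X 0" if s: "s < 4" "s > 0" for s
  proof
    fix v :: "int \<times> int"
    obtain i j where v: "v = (i, j)" by (cases v)
    note r = rule_same[OF X_ok[OF s(1), of i j] view_X[OF s(1), of i j]]
    show "Fm (X s) v = X 0 v"
    proof (cases "m (i, j) = 0")
      case True
      then show ?thesis using r y_enc[of i j] unfolding v Fm.simps by (simp add: X_def)
    next
      case False
      then have "X s (i, j) < K" using X_ge[OF s(1), of i j] by (meson not_le)
      then show ?thesis using r s(2) False unfolding v Fm.simps by (simp add: X_def)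
    qed
  qed
  have F_X0: "Fm (X 0) = y"
  proof
    fix v :: "int \<times> int"
    obtain i j where v: "v = (i, j)" by (cases v)
    have s: "(0::nat) < 4" by simp
    note r = rule_same[OF X_ok[OF s, of i j] view_X[OF s, of i j]]
    show "Fm (X 0) v = y v"
    proof (cases "m (i, j) = 0")
      case True
      then show ?thesis using r y_enc[of i j] unfolding v Fm.simps by (simp add: X_def)
    next
      case False
      then have "X 0 (i, j) < K" "y (i, j) < K" using X_ge[OF s, of i j] chain[of i j] by (meson not_le)+
      then show ?thesis using r y_enc[of i j] unfolding v Fm.simps by simp
    qed
  qed
  obtain i j where v: "v = (i, j)" by (cases v)
  have "X s \<noteq> X s'" if "s < 4" "s' < 4" "s \<noteq> s'" for s s'
  proof
    assume "X s = X s'"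
    then show False using view_X[OF that(1), of i j] view_X[OF that(2), of i j] m that(3)
      unfolding v by simp
  qed
  moreover have "X 0 \<noteq> y"
  proof
    assume "X 0 = y"
    then show False using view_X[of 0 i j] y_cell[of i j] m unfolding v by simp
  qed
  ultimately show False
    using few[of "X 0" "X 1" "X 2" "X 3"] X_conf F_X F_X0 by auto
qed

text \<open>Chain states grow by one from cell to cell towards the west, so any of them leads to a
  seed. Without a seed all cells are ordinary, none shows \<open>Bd None\<close>, and the constant
  marking 1 is legal.\<close>

lemma seed_exists: "\<exists>a b. y (a, b) = K + n"
proof (rule ccontr)
  assume no: "\<nexists>a b. y (a, b) = K + n"
  have less: "y (i, j) < K" for i j
  proof (rule ccontr)
    assume "\<not> y (i, j) < K"
    then have ge: "K \<le> y (i, j)" by simp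
    have "y (i - int d, j) = y (i, j) + d" if "y (i, j) + d \<le> K + n" for d
      using that
    proof (induction d)
      case (Suc d)
      then have "y (i - int d, j) = y (i, j) + d" by simp
      with rule_okD(2)[OF y_rule_ok[of "i - int d" j]] ge Suc.prems
      have "y (i - int d - 1, j) = Suc (y (i, j) + d)" by simp
      then show ?case by (simp add: algebra_simps)
    qed simp
    from this[of "K + n - y (i, j)"] have "y (i - int (K + n - y (i, j)), j) = K + n"
      using y_le[of "(i, j)"] by simp
    then show False using no by blast
  qed
  have "mark_ok (yt (i, j)) 1 1 1 1 1" for i j
    using y_tiles[OF less[of i j]] unfolding mark_ok_def tiles_def by auto
  then have "(1::nat) = 0"
    using no_marking[of "\<lambda>_. 1" "(0, 0)"] less by (simp add: not_le[symmetric])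
  then show False by simp
qed

context
  fixes a b
  assumes seed: "y (a, b) = K + n"
begin

text \<open>The bound \<open>Suc n\<close> is one beyond the chain, so that it includes
  \<open>K - 1\<close>, the first ordinary cell of the row.\<close>

lemma chain_row: "i \<le> Suc n \<Longrightarrow> y (a + int i, b) = K + n - i"
proof (induction i)
  case (Suc i)
  then have "y (a + int i, b) = K + n - i" by simp
  with rule_okD(1)[OF y_rule_ok[of "a + int i" b]] Suc.prems
  have "y (a + int i + 1, b) = K + n - i - 1" by simp
  then show ?case by (simp add: algebra_simps)
qed (simp add: seed)

text \<open>A chain state with an \<open>In\<close> tile needs another chain state on its left,
  where the cell is below \<open>K\<close>. Among ordinary tiles, \<open>In None {}\<close> is the
  only one with control point \<open>None\<close>.\<close>

lemma zero_row: "y (a + int (Suc n + i), b) < K \<and> yt (a + int (Suc n + i), b) = In None {}"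
proof (induction i)
  case 0
  have "y (a + int (Suc n), b) = K - 1" using chain_row[of "Suc n"] by simp
  then show ?case using view_zero K_pos unfolding yt_def by simp
next
  case (Suc i)
  let ?i = "a + int (Suc n + i)"
  have eq: "a + int (Suc n + Suc i) = ?i + 1" by simp
  obtain be where be: "yt (?i + 1, b) = In None be"
    using y_tile_ok[of ?i b] Suc by auto
  have less: "y (?i + 1, b) < K"
  proof (rule ccontr)
    assume "\<not> y (?i + 1, b) < K"
    then have ge: "K \<le> y (?i + 1, b)" by simp
    have "y (?i + 1, b) < K + n"
      using view_seed[of "y (?i + 1, b)"] be unfolding yt_def by (cases "y (?i + 1, b) < K + n") auto
    then have "y (?i + 1 - 1, b) = Suc (y (?i + 1, b))"
      using rule_okD(2)[OF y_rule_ok[of "?i + 1" b] ge] by blast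
    then have "y (?i, b) = Suc (y (?i + 1, b))" by (simp only: add_diff_cancel_right')
    then show False using ge Suc by linarith
  qed
  moreover have "be = {}" using y_tiles[OF less] be unfolding tiles_def by auto
  ultimately show ?case using be unfolding eq by simp
qed

lemma row_0: "yt (a, b) = Bd None" "yt (a + int (Suc i), b) = In None (bits RS (input n) i)"
proof -
  show "yt (a, b) = Bd None" using seed view_seed unfolding yt_def by simp
  show "yt (a + int (Suc i), b) = In None (bits RS (input n) i)"
  proof (cases "i < n")
    case True
    then have "y (a + int (Suc i), b) = K + n - Suc i" using chain_row[of "Suc i"] by simp
    moreover have "view (K + n - Suc i) = Cl (In None {0}) 0 0" by (rule view_chain) (use True in auto)
    ultimately show ?thesis using True unfolding yt_def by (simp add: bits_input del: of_nat_Suc)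
  next
    case False
    then obtain k where "i = n + k" using le_Suc_ex by (metis not_less)
    then show ?thesis using zero_row[of k] by (simp add: bits_input)
  qed
qed

definition yP :: "nat \<Rightarrow> pc" where
  "yP t = (case yt (a, b + int t) of Bd p \<Rightarrow> p | _ \<Rightarrow> None)"

text \<open>Values are computed along the control points instead of being read off the bits, since
  an arbitrary row of bits need not represent numbers; \<open>row_good\<close> then states the
  agreement.\<close>

definition yS :: "nat \<Rightarrow> nat \<Rightarrow> nat" where
  "yS = rec_nat (input n) (\<lambda>t. act (yP t))"

lemma yS_simps: "yS 0 = input n" "yS (Suc t) = act (yP t) (yS t)"
  unfolding yS_def by auto

definition row_good :: "nat \<Rightarrow> bool" where
  "row_good t \<longleftrightarrow> yt (a, b + int t) = Bd (yP t) \<and> (yP t \<in> Some ` CS \<or> yP t = None) \<and>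
     (\<forall>i. yt (a + int (Suc i), b + int t) = In (yP t) (bits RS (yS t) i))"

text \<open>The bits of the new row come from the row below, its control point from the left: the
  boundary tile chooses \<open>p'\<close> and each tile hands it on.\<close>

lemma row_step:
  assumes "row_good t"
  shows "row_good (Suc t) \<and> mstep p0 (yP t, yS t) (yP (Suc t), yS (Suc t))"
proof -
  have row: "yt (a, b + int t) = Bd (yP t)" "yP t \<in> Some ` CS \<or> yP t = None"
    "\<And>i. yt (a + int (Suc i), b + int t) = In (yP t) (bits RS (yS t) i)"
    using assms unfolding row_good_def by auto
  have row1: "yt (a + 1, b + int t) = In (yP t) (bits RS (yS t) 0)" using row(3)[of 0] by simp
  have up: "b + int t + 1 = b + int (Suc t)" by simp
  obtain p' where p': "p' \<in> nxt p0 (yP t) (bits RS (yS t) 0)" "yt (a, b + int (Suc t)) = Bd p'"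
    using y_tile_ok[of a "b + int t", unfolded up] row(1) row1 by auto
  then have P: "yP (Suc t) = p'" unfolding yP_def by simp
  have in_row: "\<exists>q. yt (a + int (Suc i), b + int (Suc t)) = In q (bits RS (yS (Suc t)) i)" for i
  proof -
    have i: "a + int (Suc i) + 1 = a + int (Suc (Suc i))" "a + int (Suc i) - 1 = a + int i" by auto
    have "tbits (yt (a + int i, b + int t)) = (if i = 0 then UNIV else bits RS (yS t) (i - 1))"
      using row(1) row(3)[of "i - 1"] by (cases i) auto
    moreover obtain q where "yt (a + int (Suc i), b + int (Suc t)) = In q (upd (yP t)
        (tbits (yt (a + int i, b + int t))) (bits RS (yS t) i) (bits RS (yS t) (Suc i)))"
      using y_tile_ok[of "a + int (Suc i)" "b + int t", unfolded up i] row(3)[of i] row(3)[of "Suc i"]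
      by (auto simp del: of_nat_Suc)
    ultimately show ?thesis using bits_upd[OF row(2), of "yS t"] yS_simps(2)[of t]
      by (cases i) auto
  qed
  have "yt (a + int (Suc i), b + int (Suc t)) = In p' (bits RS (yS (Suc t)) i)" for i
  proof (induction i)
    case 0
    obtain be where "yt (a + 1, b + int (Suc t)) = In p' be"
      using y_tile_ok[of a "b + int (Suc t)"] p'(2) by auto
    then show ?case using in_row[of 0] by auto
  next
    case (Suc i)
    have i: "a + int (Suc i) + 1 = a + int (Suc (Suc i))" by simp
    obtain be where "yt (a + int (Suc (Suc i)), b + int (Suc t)) = In p' be"
      using y_tile_ok[of "a + int (Suc i)" "b + int (Suc t)", unfolded i] Suc by (auto simp del: of_nat_Suc)
    then show ?case using in_row[of "Suc i"] by (auto simp del: of_nat_Suc)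
  qed
  moreover have "p' \<in> Some ` CS" using nxt_in_CS[OF row(2) p'(1)] .
  ultimately have "row_good (Suc t)" unfolding row_good_def using P p'(2) by simp
  moreover have "mstep p0 (yP t, yS t) (yP (Suc t), yS (Suc t))"
    unfolding mstep_def using p'(1) P yS_simps(2) nxt_bits[OF row(2)] by simp
  ultimately show ?thesis ..
qed

lemma all_rows: "row_good t"
proof (induction t)
  case 0
  have "yP 0 = None" unfolding yP_def using row_0(1) by simp
  then show ?case unfolding row_good_def using row_0 yS_simps(1) by (simp del: of_nat_Suc)
qed (use row_step in blast)

lemma fair_run_exists: "fair_run p0 n yP yS"
proof -
  have "\<exists>t'\<ge>t. \<not> is_guess (yP t')" for t
  proof (rule ccontr)
    assume "\<not> (\<exists>t'\<ge>t. \<not> is_guess (yP t'))"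
    then have guess: "\<And>t'. t' \<ge> t \<Longrightarrow> is_guess (yP t')" by blast
    define m :: "int \<times> int \<Rightarrow> nat" where "m v = (if fst v = a \<and> snd v \<ge> b + int t then 2 else 0)" for v
    have col: "\<exists>p. is_guess p \<and> yt (a, j) = Bd p \<and> (\<exists>c. yt (a + 1, j) = In p c)" if "j \<ge> b + int t" for j
    proof -
      define k where "k = nat (j - b)"
      then have j: "j = b + int k" using that by simp
      then have "is_guess (yP k)" using that guess by simp
      then show ?thesis using all_rows[of k] unfolding row_good_def j
        by (metis int_ops(2) One_nat_def)
    qed
    have m_not: "m (i, j) = 0" if "\<And>p. is_guess p \<Longrightarrow> yt (i, j) \<noteq> Bd p" for i j
      using that col unfolding m_def by auto
    have "m (a, b + int t) = 0"
    proof (rule no_marking)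
      show "mark_ok (yt (i, j)) (m (i, j)) (m (i + 1, j)) (m (i - 1, j)) (m (i, j + 1)) (m (i, j - 1))" for i j
        using col[of j] unfolding mark_ok_def m_def by auto
      fix i j
      assume ge: "K \<le> y (i, j)"
      have "m (i, j) = 0" by (rule m_not) (use y_ge_tile[OF ge] in \<open>auto simp: is_guess_def\<close>)
      moreover have "m (i + 1, j) = 0"
      proof (rule m_not)
        have e: "y (i + 1, j) = y (i, j) - 1" using rule_okD(1)[OF y_rule_ok ge] .
        have "yt (i + 1, j) = In None {} \<or> yt (i + 1, j) = In None {0} \<or> yt (i + 1, j) = Bd None"
        proof (cases "y (i, j) = K")
          case True
          then show ?thesis using e view_zero unfolding yt_def by simp
        next
          case False
          then show ?thesis using y_ge_tile[of "(i + 1, j)"] ge e by auto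
        qed
        then show "yt (i + 1, j) \<noteq> Bd p" if "is_guess p" for p using that by (auto simp: is_guess_def)
      qed
      \<comment> \<open>A mark on the left would give this cell a guessing control point, but chain
        states show \<open>None\<close>.\<close>
      moreover have "m (i - 1, j) = 0"
      proof (rule ccontr)
        assume "m (i - 1, j) \<noteq> 0"
        then have "i - 1 = a" "j \<ge> b + int t" unfolding m_def by (auto split: if_splits)
        then show False using col[of j] y_ge_tile[OF ge] by (auto simp: is_guess_def)
      qed
      ultimately show "m (i, j) = 0 \<and> m (i + 1, j) = 0 \<and> m (i - 1, j) = 0" by blast
    qed (simp add: m_def)
    then show False unfolding m_def by simp
  qed
  moreover have "yP 0 = None" unfolding yP_def using row_0(1) by simp
  ultimately show ?thesis unfolding fair_run_def using yS_simps(1) row_step[OF all_rows] by blast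
qed

end

lemma fair_run_if_fixed: "\<exists>P S. fair_run p0 n P S"
  using seed_exists fair_run_exists by blast

end

lemma sat_iff: "sat \<longleftrightarrow> (\<exists>P S. fair_run p0 n P S)"
proof
  assume sat
  then obtain y where y: "is_config (Suc (K + n)) y" "Fm y = y"
    "\<forall>y' y1 y2 y3. is_config (Suc (K + n)) y' \<and> is_config (Suc (K + n)) y1 \<and>
        is_config (Suc (K + n)) y2 \<and> is_config (Suc (K + n)) y3 \<longrightarrow>
          (y' \<noteq> y \<and> Fm y' = y \<and> Fm y1 = y' \<and> Fm y2 = y' \<and> Fm y3 = y') \<longrightarrow>
          (y1 = y2 \<or> y1 = y3 \<or> y2 = y1 \<or> y2 = y3 \<or> y3 = y1 \<or> y3 = y2)"
    unfolding sat_def by (elim exE conjE)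
  show "\<exists>P S. fair_run p0 n P S"
  proof (rule fair_run_if_fixed[OF y(1,2)])
    fix y' y1 y2 y3
    assume "is_config (Suc (K + n)) y'" "is_config (Suc (K + n)) y1"
      "is_config (Suc (K + n)) y2" "is_config (Suc (K + n)) y3"
      "y' \<noteq> y" "Fm y' = y" "Fm y1 = y'" "Fm y2 = y'" "Fm y3 = y'"
    then show "y1 = y2 \<or> y1 = y3 \<or> y2 = y3"
      using y(3)[rule_format, of y' y1 y2 y3] by auto
  qed
qed (use sat_if_fair_run in blast)

end

section \<open>Codes of local rules\<close>

text \<open>With cap 1 and radius 1 the index of a pattern has, for the \<open>j\<close>-th word, exactly one nonzero bit among the
  positions \<open>j * N, \<dots>, j * N + N - 1\<close>; \<open>sel\<close> finds it, with \<open>N\<close> as default for indices of no pattern.\<close>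

definition sel :: "nat \<Rightarrow> nat \<Rightarrow> nat \<Rightarrow> nat" where
  "sel N j i = (LEAST s. s = N \<or> odd (i div 2 ^ (j * N + s)))"

lemma rec_fun_sel:
  assumes "rec_fun k N" "rec_fun k i"
  shows "rec_fun k (\<lambda>xs. sel (N xs) j (i xs))"
  unfolding sel_def
  by (intro rec_pred_Least rec_pred_disj rec_pred_eq rec_pred_odd rec_fun_div rec_fun_power rec_fun_add rec_fun_mult rec_fun_const rec_fun_proj
      rec_fun_drop1[OF assms(1)] rec_fun_drop1[OF assms(2)]) auto

lemma odd_sum_bits:
  fixes b :: "nat \<Rightarrow> bool"
  shows "odd ((\<Sum>i<M. of_bool (b i) * 2 ^ i) div 2 ^ k :: nat) \<longleftrightarrow> k < M \<and> b k"
proof -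
  have "(\<Sum>i<M. of_bool (b i) * 2 ^ i) = (horner_sum of_bool 2 (map b [0..<M]) :: nat)"
    by (simp add: horner_sum_eq_sum atLeast0LessThan)
  then show ?thesis
    using bit_horner_sum_bit_iff[where 'a = nat, of "map b [0..<M]" k]
    by (auto simp: bit_iff_odd)
qed

lemma sum_bits_less: "(\<Sum>i<M. of_bool (b i) * 2 ^ i :: nat) < 2 ^ M"
  by (induction M) (auto simp: of_bool_def)

lemma words_upto_1: "words_upto 1 = [[], [(1,0)], [(-1,0)], [(0,1)], [(0,-1)]]"
  unfolding words_upto_def Delta_def by (simp add: upt_rec)

fun move :: "vertex \<Rightarrow> vertex list \<Rightarrow> vertex" where
  "move v [] = v"
| "move v (d # w) = move (fst v + fst d, snd v + snd d) w"

lemma reach_move: "reach w v = {move v w}"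
  by (induction w v rule: reach.induct) (auto simp: edges_def)

text \<open>A word leads from a vertex to exactly one vertex, so all counts are 0 or 1 and cap 1
  loses nothing.\<close>

lemma pattern_eq:
  "pattern N x v r 1 (w, s) = of_bool (w \<in> set (words_upto r) \<and> s < N \<and> x (move v w) = s)"
proof -
  have "{v' \<in> {move v w}. x v' = s} = (if x (move v w) = s then {move v w} else {})" by auto
  then have "card {v' \<in> {move v w}. x v' = s} = of_bool (x (move v w) = s)" by (simp only:) simp
  then show ?thesis unfolding pattern_def reach_move prod.case by (simp only:) auto
qed

text \<open>\<open>dom_list\<close> runs through the states faster than through the words, so
  position \<open>i\<close> belongs to word number \<open>i div N\<close> and state
  \<open>i mod N\<close>.\<close>

lemma ms_index_pattern:
  "ms_index N 1 1 (pattern N x v 1 1)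
     = (\<Sum>i<5 * N. of_bool (x (move v (words_upto 1 ! (i div N))) = i mod N) * 2 ^ i)"
proof -
  have len: "length (dom_list N 1) = 5 * N" unfolding dom_list_def words_upto_1 by simp
  have "pattern N x v 1 1 (dom_list N 1 ! i) = of_bool (x (move v (words_upto 1 ! (i div N))) = i mod N)"
    if "i < 5 * N" for i
  proof -
    have lt: "i div N < 5" "i mod N < N" using that by (auto simp: less_mult_imp_div_less mult.commute intro: gr0I)
    have "dom_list N 1 ! i = (words_upto 1 ! (i div N), i mod N)"
    proof -
      have "i < length (words_upto 1) * length [0..<N]" using that unfolding words_upto_1 by simp
      from product_nth[OF this] show ?thesis unfolding dom_list_def using lt by simp
    qed
    moreover have "words_upto 1 ! (i div N) \<in> set (words_upto 1)"
      unfolding words_upto_1 using lt by (intro nth_mem) simp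
    ultimately show ?thesis using lt by (simp only: pattern_eq) simp
  qed
  then show ?thesis unfolding ms_index_def len by (simp add: numeral_2_eq_2)
qed

lemma sel_ms_index:
  assumes "is_config N x" "j < 5"
  shows "sel N j (ms_index N 1 1 (pattern N x v 1 1)) = x (move v (words_upto 1 ! j))"
proof -
  let ?s = "x (move v (words_upto 1 ! j))"
  have s: "?s < N" using assms(1)[unfolded is_config_def] by (cases "move v (words_upto 1 ! j)") simp
  have odd: "odd (ms_index N 1 1 (pattern N x v 1 1) div 2 ^ (j * N + s)) \<longleftrightarrow> ?s = s" if "s < N" for s
  proof -
    have "j * N + s < 5 * N"
    proof -
      have "j * N + s < j * N + N" using that by simp
      also have "\<dots> = Suc j * N" by simp
      also have "\<dots> \<le> 5 * N" using assms(2) by (intro mult_le_mono1) simp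
      finally show ?thesis .
    qed
    then show ?thesis unfolding ms_index_pattern odd_sum_bits using that by simp
  qed
  show ?thesis unfolding sel_def
  proof (rule Least_equality)
    show "?s = N \<or> odd (ms_index N 1 1 (pattern N x v 1 1) div 2 ^ (j * N + ?s))" using odd[OF s] by blast
    fix s
    assume "s = N \<or> odd (ms_index N 1 1 (pattern N x v 1 1) div 2 ^ (j * N + s))"
    then show "?s \<le> s" using odd[of s] s by (cases "s < N") auto
  qed
qed

section \<open>The code of the local rule\<close>

context ca
begin

lemma cell_step_cells: "q \<in> cells CS RS \<Longrightarrow> cell_step k q \<in> cells CS RS"
  by (cases q) (auto simp: Cl_in_cells Er_in_cells)

lemma rule_lt: "c < Suc (K + n) \<Longrightarrow> rule c e w u d < Suc (K + n)"
proof (cases "c < K")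
  case True
  then have "enc (cell_step (rule_ok c e w u d) (D c)) < K" by (intro enc_less cell_step_cells D_cells)
  then show ?thesis using True unfolding rule_def by simp
next
  case False
  have "enc (Er False) < K" by (intro enc_less Er_in_cells)
  then show "c < Suc (K + n) \<Longrightarrow> ?thesis" using False unfolding rule_def by simp
qed

text \<open>The guard is for indices of no pattern, where \<open>sel\<close> may return
  \<open>N\<close> and \<open>rule\<close> could pass it on as a state. In the other four cells
  \<open>N\<close> is harmless, as the result is bounded once the centre is.\<close>

definition entry :: "nat \<Rightarrow> nat" where
  "entry i = (let N = Suc (K + n) in if sel N 0 i < N
     then rule (sel N 0 i) (sel N 1 i) (sel N 2 i) (sel N 3 i) (sel N 4 i) else 0)"

definition code :: nat where
  "code = list_encode [Suc (K + n), 1, 1, list_encode (map entry [0..<2 ^ (5 * Suc (K + n))])]"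

lemma code_components: "code_states code = Suc (K + n)" "code_radius code = 1" "code_cap code = 1"
  "code_table code = map entry [0..<2 ^ (5 * Suc (K + n))]" "length (list_decode code) = 4"
  unfolding code_states_def code_radius_def code_cap_def code_table_def code_def
  by (simp_all add: numeral_2_eq_2 numeral_3_eq_3 del: list_encode.simps upt_Suc)

lemma entry_less: "entry i < Suc (K + n)"
  unfolding entry_def Let_def using rule_lt by auto

lemma valid_code: "valid_rule_code code"
proof -
  have "length (dom_list (Suc (K + n)) 1) = 5 * Suc (K + n)"
    unfolding dom_list_def words_upto_1 by simp
  then show ?thesis
    unfolding valid_rule_code_def code_components using entry_less by (auto simp: numeral_2_eq_2)
qed

lemma global_map_code:
  assumes "is_config (Suc (K + n)) x"
  shows "global_map code x = Fm x"
proof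
  fix v :: "int \<times> int"
  obtain i j where v: "v = (i, j)" by (cases v)
  let ?N = "Suc (K + n)"
  let ?I = "ms_index ?N 1 1 (pattern ?N x v 1 1)"
  have I: "?I < 2 ^ (5 * ?N)" unfolding ms_index_pattern by (rule sum_bits_less)
  have "global_map code x v = entry ?I"
    unfolding global_map_def local_rule_def code_components using I by (simp del: upt_Suc)
  moreover have "sel ?N 0 ?I = x (i, j)" "sel ?N 1 ?I = x (i + 1, j)" "sel ?N 2 ?I = x (i - 1, j)"
    "sel ?N 3 ?I = x (i, j + 1)" "sel ?N 4 ?I = x (i, j - 1)"
    using sel_ms_index[OF assms, of 0 v] sel_ms_index[OF assms, of 1 v] sel_ms_index[OF assms, of 2 v]
      sel_ms_index[OF assms, of 3 v] sel_ms_index[OF assms, of 4 v]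
    unfolding words_upto_1 v by (simp_all add: numeral_2_eq_2 numeral_3_eq_3 eval_nat_numeral)
  moreover have "x (i, j) < ?N" using assms unfolding is_config_def by blast
  ultimately show "global_map code x v = Fm x v" unfolding v Fm.simps entry_def by (simp add: Let_def)
qed

lemma satisfies_phi_code: "satisfies_phi code \<longleftrightarrow> sat"
  unfolding satisfies_phi_def sat_def code_components Let_def
  by (intro ex_cong1 conj_cong refl all_cong1 imp_cong) (auto simp: global_map_code)

end

text \<open>The number of states grows with \<open>n\<close>, but after \<open>proj\<close>
  everything about tiles is one fixed finite table; what remains is arithmetic and
  comparisons.\<close>

lemma computable_code:
  assumes ca: "ca p0 CS RS K D"
  shows "computable1 (\<lambda>n. ca.code p0 K n D)"
proof -
  define E where "E = ca.enc K D"
  \<comment> \<open>The value \<open>K\<close> stands for keeping the central state, which the table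
    cannot return because it only sees the projection.\<close>
  define table where "table l = (let ok = cell_ok p0 (D (l ! 0)) (D (l ! 1)) (D (l ! 2)) (D (l ! 3)) (D (l ! 4)) in
      if l ! 0 < K then E (cell_step ok (D (l ! 0))) else if ok then K else E (Er False))" for l
  define S where "S = {l :: nat list. set l \<subseteq> {..Suc K} \<and> length l = 5}"
  have "finite S" unfolding S_def by (rule finite_lists_length_eq) simp
  then have rec_fun_table: "rec_fun 5 (\<lambda>l. if l \<in> S then table l else 0)"
    by (rule rec_fun_finite_support) (simp add: S_def)
  have rec_fun_proj': "rec_fun k (\<lambda>xs. ca.proj K (n xs) (c xs))" if "rec_fun k n" "rec_fun k c" for k n c
    unfolding ca.proj_def[OF ca] by (intro rec_fun_if rec_pred_less rec_fun_add rec_fun_const that)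
  have proj_le: "ca.proj K n s \<le> Suc K" for n s unfolding ca.proj_def[OF ca] by auto
  have proj_less: "ca.proj K n s < K \<longleftrightarrow> s < K" for n s unfolding ca.proj_def[OF ca] by auto
  have proj_id: "s < K \<Longrightarrow> ca.proj K n s = s" for n s unfolding ca.proj_def[OF ca] by auto
  have E_less: "s < K \<Longrightarrow> E (cell_step ok (D s)) < K" for s ok
    unfolding E_def using ca.enc_less[OF ca] ca.cell_step_cells[OF ca] ca.D_cells[OF ca] by blast
  have E_Er: "E (Er False) < K"
    unfolding E_def using ca.enc_less[OF ca] Er_in_cells by blast
  define tab where "tab n c e w u d = (\<lambda>l. if l \<in> S then table l else 0)
      [ca.proj K n c, ca.proj K n e, ca.proj K n w, ca.proj K n u, ca.proj K n d]" for n c e w u d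
  have rule_eq: "ca.rule p0 K n D c e w u d = (if ca.chain_ok K n c e w then
      if K \<le> tab n c e w u d then c else tab n c e w u d else E (Er False))" for n c e w u d
  proof -
    have "[ca.proj K n c, ca.proj K n e, ca.proj K n w, ca.proj K n u, ca.proj K n d] \<in> S"
      unfolding S_def using proj_le by simp
    then have tab: "tab n c e w u d = (let ok = cell_ok p0 (ca.view K n D c) (ca.view K n D e)
          (ca.view K n D w) (ca.view K n D u) (ca.view K n D d) in
        if c < K then E (cell_step ok (D c)) else if ok then K else E (Er False))"
      unfolding tab_def table_def ca.view_def[OF ca]
      using proj_less[of n c] proj_id[of c n] by (simp add: Let_def eval_nat_numeral)
    show ?thesis
    proof (cases "c < K")
      case True
      then have "ca.chain_ok K n c e w" unfolding ca.chain_ok_def[OF ca] by simp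
      then show ?thesis using True tab E_less[OF True]
        unfolding ca.rule_def[OF ca] ca.rule_ok_def[OF ca] E_def by (simp add: Let_def not_le[symmetric])
    next
      case False
      then show ?thesis using tab E_Er
        unfolding ca.rule_def[OF ca] ca.rule_ok_def[OF ca] E_def by (simp add: Let_def)
    qed
  qed
  have rec_fun_rule: "rec_fun k (\<lambda>xs. ca.rule p0 K (n xs) D (c xs) (e xs) (w xs) (u xs) (d xs))"
    if n: "rec_fun k n" and c: "rec_fun k c" "rec_fun k e" "rec_fun k w" "rec_fun k u" "rec_fun k d" for k n c e w u d
  proof -
    let ?gs = "[\<lambda>xs. ca.proj K (n xs) (c xs), \<lambda>xs. ca.proj K (n xs) (e xs), \<lambda>xs. ca.proj K (n xs) (w xs),
         \<lambda>xs. ca.proj K (n xs) (u xs), \<lambda>xs. ca.proj K (n xs) (d xs)]"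
    have "rec_fun (length ?gs) (\<lambda>l. if l \<in> S then table l else 0)" using rec_fun_table by (simp add: numeral_eq_Suc)
    moreover have "rec_fun k g" if "g \<in> set ?gs" for g
      using that rec_fun_proj'[OF n c(1)] rec_fun_proj'[OF n c(2)] rec_fun_proj'[OF n c(3)] rec_fun_proj'[OF n c(4)]
        rec_fun_proj'[OF n c(5)] by auto
    ultimately have "rec_fun k (\<lambda>xs. (\<lambda>l. if l \<in> S then table l else 0) (map (\<lambda>g. g xs) ?gs))"
      by (rule rec_fun_comp)
    then have tab: "rec_fun k (\<lambda>xs. tab (n xs) (c xs) (e xs) (w xs) (u xs) (d xs))"
      unfolding tab_def list.map .
    have "rec_pred k (\<lambda>xs. ca.chain_ok K (n xs) (c xs) (e xs) (w xs))"
      unfolding ca.chain_ok_def[OF ca]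
      by (intro rec_pred_conj rec_pred_imp rec_pred_le rec_pred_less rec_pred_eq rec_fun_pred rec_fun_Suc rec_fun_add rec_fun_const n c)
    then show ?thesis unfolding rule_eq by (intro rec_fun_if rec_pred_le rec_fun_const tab c)
  qed
  have "rec_fun (Suc 1) (\<lambda>ys. ca.entry p0 K (drop 1 ys ! 0) D (ys ! 0))"
    unfolding ca.entry_def[OF ca] Let_def
    by (intro rec_fun_if rec_pred_less rec_fun_rule rec_fun_sel rec_fun_Suc rec_fun_add rec_fun_const rec_fun_proj rec_fun_nth_drop; simp)
  then have "rec_fun 1 (\<lambda>xs. list_encode (map (\<lambda>i. ca.entry p0 K (xs ! 0) D i) [0..<2 ^ (5 * Suc (K + xs ! 0))]))"
    by (rule rec_fun_list_encode_map) (intro rec_fun_power rec_fun_mult rec_fun_Suc rec_fun_add rec_fun_const rec_fun_proj; simp)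
  then show ?thesis
    unfolding computable1_iff ca.code_def[OF ca] list_encode.simps
    by (intro rec_fun_Suc rec_fun_prod_encode rec_fun_add rec_fun_const rec_fun_proj) simp_all
qed

text \<open>The last element is prescribed because the chain of special states descends to
  \<open>K - 1\<close>, which must be the cell of time 0 with all registers zero.\<close>

lemma finite_bij_last:
  assumes "finite A" "q \<in> A"
  shows "\<exists>h. bij_betw h {..<card A} A \<and> h (card A - 1) = q"
proof -
  have card: "card A = Suc (card (A - {q}))" using assms card_Suc_Diff1 by metis
  obtain h where h: "bij_betw h {0..<card (A - {q})} (A - {q})"
    using ex_bij_betw_nat_finite[of "A - {q}"] assms(1) by auto
  let ?h = "h(card (A - {q}) := q)"
  have "bij_betw ?h {0..<card (A - {q})} (A - {q})"
    by (rule bij_betw_cong[THEN iffD1, OF _ h]) auto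
  then have "bij_betw ?h ({0..<card (A - {q})} \<union> {card (A - {q})}) ((A - {q}) \<union> {q})"
    by (rule bij_betw_combine) auto
  moreover have "{0..<card (A - {q})} \<union> {card (A - {q})} = {..<card A}" using card by auto
  moreover have "(A - {q}) \<union> {q} = A" using assms(2) by auto
  ultimately show ?thesis using card by (intro exI[of _ ?h]) simp
qed

theorem mainTheorem12:
  shows "Sigma11_hard {c. valid_rule_code c \<and> satisfies_phi c}"
  unfolding Sigma11_hard_def
proof (intro allI impI)
  fix A
  assume "Sigma11 A"
  then obtain T e where T: "\<And>n c c'. eval_recf e [n, c, c'] (T n c c')" "\<And>n c. T n c 0 \<noteq> 0"
    and A: "\<And>n. n \<in> A \<longleftrightarrow> (\<exists>c. c 0 = 0 \<and> (\<forall>i. T n (c i) (c (Suc i)) = 0))"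
    by (rule Sigma11_chain) blast
  interpret guess_loop T e by unfold_locales (fact T)+
  define CS where "CS = conts prog []"
  define RS where "RS = insert 0 (head_reg ` CS)"
  have fin: "finite CS" "finite RS" unfolding RS_def CS_def using finite_conts by auto
  define K where "K = card (cells CS RS)"
  have "Cl (In None {}) 0 0 \<in> cells CS RS" by (simp add: Cl_in_cells tiles_def)
  then obtain D0 where D0: "bij_betw D0 {..<K} (cells CS RS)" "D0 (K - 1) = Cl (In None {}) 0 0"
    using finite_bij_last[OF finite_cells[OF fin]] unfolding K_def by blast
  \<comment> \<open>Beyond the enumeration of the cells, \<open>K\<close> and \<open>Suc K\<close>
    hold the appearance of the input states and of the seed.\<close>
  define D where "D = D0(K := Cl (In None {0}) 0 0, Suc K := Cl (Bd None) 0 0)"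
  have D_eq: "D s = D0 s" if "s < K" for s using that unfolding D_def by simp
  have "K > 0" unfolding K_def using finite_cells[OF fin] Er_in_cells[of True CS RS]
    by (auto simp: card_gt_0_iff)
  have ca: "ca prog CS RS K D"
  proof
    show "prog \<in> CS" unfolding CS_def using conts_start[of prog "[]"] by simp
    show "q \<in> Some ` CS" if "l \<in> CS" "q \<in> nxt prog (Some l) Z" for l q Z
    proof (cases "l = []")
      case False
      then show ?thesis using that conts_nxt unfolding CS_def by blast
    qed (use that in simp)
    show "bij_betw D {..<K} (cells CS RS)"
      by (rule bij_betw_cong[THEN iffD1, OF _ D0(1)]) (simp add: D_eq)
    show "D (K - 1) = Cl (In None {}) 0 0" using D_eq[of "K - 1"] D0(2) \<open>K > 0\<close> by simp
  qed (auto simp: RS_def D_def)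
  have "n \<in> A \<longleftrightarrow> ca.code prog K n D \<in> {c. valid_rule_code c \<and> satisfies_phi c}" for n
    using A[of n] fair_run_iff[of n] ca.sat_iff[OF ca] ca.satisfies_phi_code[OF ca] ca.valid_code[OF ca]
    by simp
  then show "\<exists>g. computable1 g \<and> (\<forall>n. (n \<in> A) = (g n \<in> {c. valid_rule_code c \<and> satisfies_phi c}))"
    using computable_code[OF ca] by blast
qed

end
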